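(* Let $0<a<b<\pi$, let $p,q\in L_1[0,\pi]$ be complex-valued, let $j\in\{0,1\}$, and let $\{\lambda_{nj}\}_{n\ge1}$ be the spectrum of the boundary value problem ${\mathcal L}_j(p,q)$. For $n\ge1$ put $s_{nj}=a_{nj}+b_{nj}$, where $$a_{n0}=\frac2\pi\sin na\int_0^\pi\sin nt\,p(t)\,dt,\qquad a_{n1}=\frac2\pi\cos\Big(n-\frac12\Big)a\int_0^\pi\cos\Big(n-\frac12\Big)t\;p(t)\,dt,$$ $$b_{n0}=\frac2\pi\sin nb\int_0^\pi\sin nt\,q(t)\,dt,\qquad b_{n1}=\frac2\pi\cos\Big(n-\frac12\Big)b\int_0^\pi\cos\Big(n-\frac12\Big)t\;q(t)\,dt .$$ Then the series $\sum_{n=1}^\infty\Big(\lambda_{nj}-\big(n-\frac j2\big)^2\Big)$ converges if and only if the series $\sum_{n=1}^\infty s_{nj}$ converges. In the case of convergence, $$\sum_{n=1}^\infty\Big(\lambda_{nj}-\big(n-\tfrac j2\big)^2\Big)=\sum_{n=1}^\infty s_{nj}.$$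
   Context: For $j\in\{0,1\}$, ${\mathcal L}_j(p,q)$ is the boundary value problem with two frozen arguments $a,b$ $$-y''(x)+p(x)y(a)+q(x)y(b)=\lambda y(x),\quad x\in(0,\pi),\qquad y^{(j)}(0)=y(\pi)=0,$$ with spectral parameter $\lambda\in\mathbb C$; here $y^{(0)}=y$, $y^{(1)}=y'$. Its spectrum $\{\lambda_{nj}\}_{n\ge1}$ is the sequence of eigenvalues, i.e. of the zeros, counted with multiplicity and numbered so that $|\lambda_{1j}|\le|\lambda_{2j}|\le\cdots$, of the characteristic function, which is the entire function of $\lambda=\rho^2$ $$\Delta_j(\lambda)=\left|\begin{array}{ccc} \varphi_j(\rho,\pi) & \int_0^\pi \frac{\sin\rho(\pi-t)}{\rho}p(t)\,dt & \int_0^\pi \frac{\sin\rho(\pi-t)}{\rho}q(t)\,dt\\ \varphi_j(\rho,a) & \int_0^a \frac{\sin\rho(a-t)}{\rho}p(t)\,dt-1 & \int_0^a \frac{\sin\rho(a-t)}{\rho}q(t)\,dt\\ \varphi_j(\rho,b) & \int_0^b \frac{\sin\rho(b-t)}{\rho}p(t)\,dt & \int_0^b \frac{\sin\rho(b-t)}{\rho}q(t)\,dt-1 \end{array}\right|,$$ where $\varphi_0(\rho,z)=\rho^{-1}\sin\rho z$ and $\varphi_1(\rho,z)=\cos\rho z$ (values at $\rho=0$ are understood by continuity). Here $\cos\big(n-\frac12\big)a$ means $\cos\big((n-\frac12)a\big)$, and similarly for the other trigonometric expressions. *)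

theory Defs
  imports "HOL-Complex_Analysis.Complex_Analysis"
begin

text \<open>The function \<open>sin (\<rho> * x) / \<rho>\<close>, extended to \<open>\<rho> = 0\<close> by continuity.\<close>

definition sin_quot :: "complex \<Rightarrow> real \<Rightarrow> complex" where
  "sin_quot \<rho> x = (if \<rho> = 0 then of_real x else sin (\<rho> * of_real x) / \<rho>)"

definition phi :: "nat \<Rightarrow> complex \<Rightarrow> real \<Rightarrow> complex" where
  "phi j \<rho> x = (if j = 0 then sin_quot \<rho> x else cos (\<rho> * of_real x))"

definition sin_conv :: "(real \<Rightarrow> complex) \<Rightarrow> complex \<Rightarrow> real \<Rightarrow> complex" where
  "sin_conv f \<rho> x = (LINT t:{0..x}|lebesgue. sin_quot \<rho> (x - t) * f t)"

text \<open>
  The characteristic determinant of the problem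
  \<open>-y''(x) + p(x) y(a) + q(x) y(b) = \<lambda> y(x)\<close> on \<open>(0, pi)\<close>, with \<open>y(0) = y(pi) = 0\<close> for
  \<open>j = 0\<close> and \<open>y'(0) = y(pi) = 0\<close> for \<open>j = 1\<close>, where \<open>\<lambda> = \<rho>^2\<close>.
\<close>

definition char_det ::
  "nat \<Rightarrow> real \<Rightarrow> real \<Rightarrow> (real \<Rightarrow> complex) \<Rightarrow> (real \<Rightarrow> complex) \<Rightarrow> complex \<Rightarrow> complex" where
  "char_det j a b p q \<rho> = det (vector
     [vector [phi j \<rho> pi, sin_conv p \<rho> pi,    sin_conv q \<rho> pi],
      vector [phi j \<rho> a,  sin_conv p \<rho> a - 1, sin_conv q \<rho> a],
      vector [phi j \<rho> b,  sin_conv p \<rho> b,     sin_conv q \<rho> b - 1]] :: complex ^ 3 ^ 3)"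

text \<open>
  The determinant is even in \<open>\<rho>\<close>, so it is a function of \<open>\<lambda> = \<rho>^2\<close> and the branch of the
  square root is immaterial; see \<open>char_fun_square\<close> below.
\<close>

definition char_fun ::
  "nat \<Rightarrow> real \<Rightarrow> real \<Rightarrow> (real \<Rightarrow> complex) \<Rightarrow> (real \<Rightarrow> complex) \<Rightarrow> complex \<Rightarrow> complex" where
  "char_fun j a b p q z = char_det j a b p q (csqrt z)"

lemma sin_quot_minus: "sin_quot (- \<rho>) x = sin_quot \<rho> x"
  by (simp add: sin_quot_def)

lemma char_det_minus: "char_det j a b p q (- \<rho>) = char_det j a b p q \<rho>"
  by (simp add: char_det_def phi_def sin_conv_def sin_quot_minus)

lemma char_fun_square: "char_fun j a b p q (\<rho>\<^sup>2) = char_det j a b p q \<rho>"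
proof -
  have "(csqrt (\<rho>\<^sup>2))\<^sup>2 = \<rho>\<^sup>2" by simp
  then have "csqrt (\<rho>\<^sup>2) = \<rho> \<or> csqrt (\<rho>\<^sup>2) = - \<rho>" by (simp only: power2_eq_iff)
  then show ?thesis by (auto simp: char_fun_def char_det_minus)
qed

text \<open>
  \<open>lam 1, lam 2, \<dots>\<close> enumerates the zeros of the characteristic function with their
  multiplicities, in order of nondecreasing modulus; \<open>lam 0\<close> is not used.
  Since the characteristic function is entire and not identically zero, \<open>zorder\<close> at \<open>z\<close> is
  the multiplicity of the zero \<open>z\<close>, and is \<open>0\<close> if \<open>z\<close> is not a zero.
\<close>

definition is_spectrum ::
  "nat \<Rightarrow> real \<Rightarrow> real \<Rightarrow> (real \<Rightarrow> complex) \<Rightarrow> (real \<Rightarrow> complex) \<Rightarrow> (nat \<Rightarrow> complex) \<Rightarrow> bool" where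
  "is_spectrum j a b p q lam \<longleftrightarrow>
     (\<forall>m n. 1 \<le> m \<and> m \<le> n \<longrightarrow> norm (lam m) \<le> norm (lam n)) \<and>
     (\<forall>z. finite {n. 1 \<le> n \<and> lam n = z} \<and>
          int (card {n. 1 \<le> n \<and> lam n = z}) = zorder (char_fun j a b p q) z)"

definition trig_fun :: "nat \<Rightarrow> nat \<Rightarrow> real \<Rightarrow> real" where
  "trig_fun j n x = (if j = 0 then sin (real n * x) else cos ((real n - 1 / 2) * x))"

text \<open>
  The numbers \<open>a\<^sub>n\<^sub>j\<close> and \<open>b\<^sub>n\<^sub>j\<close> are \<open>trig_term j a p n\<close> and \<open>trig_term j b q n\<close>.
\<close>

definition trig_term :: "nat \<Rightarrow> real \<Rightarrow> (real \<Rightarrow> complex) \<Rightarrow> nat \<Rightarrow> complex" where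
  "trig_term j c f n =
     of_real (2 / pi * trig_fun j n c) * (LINT t:{0..pi}|lebesgue. of_real (trig_fun j n t) * f t)"

end

theory Submission
  imports Defs
begin

text \<open>
  Write \<open>\<lambda> = \<rho>\<^sup>2\<close> and let \<open>\<Phi>\<close> be the characteristic function for \<open>p = q = 0\<close>; its zeros are the
  numbers \<open>(n - j/2)\<^sup>2\<close> and they are simple. The terms \<open>p(x) y(a) + q(x) y(b)\<close> are a perturbation of
  rank two, so the characteristic function \<open>\<Delta>\<close> satisfies \<open>\<Delta> / \<Phi> = det (I + M)\<close>, where the entries
  of the 2-by-2 matrix \<open>M\<close> are the integrals of \<open>p\<close> and \<open>q\<close> against the unperturbed Green function
  with one argument frozen at \<open>a\<close> or \<open>b\<close> (lemma \<open>char_det_green\<close>).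

  On the circles \<open>\<bar>\<rho>\<bar> = R\<^sub>N = N + 1/2 - j/2\<close>, which keep away from the zeros of \<open>\<Phi>\<close>, the Green
  function is \<open>O(1/R\<^sub>N)\<close>, and a Riemann--Lebesgue argument improves this to \<open>M = o(1/R\<^sub>N)\<close>
  (\<open>green_quotient_small\<close>). Therefore \<open>ln (\<Delta>/\<Phi>) = tr M + o(1/R\<^sub>N\<^sup>2)\<close> there. The circle
  \<open>\<bar>\<lambda>\<bar> = R\<^sub>N\<^sup>2\<close> has length \<open>2 \<pi> R\<^sub>N\<^sup>2\<close>, hence the contour integrals of \<open>ln (\<Delta>/\<Phi>)\<close> and of
  \<open>tr M\<close> over it differ by \<open>o(1)\<close>.

  Both integrals are known. By the argument principle and integration by parts, the first one is
  \<open>-2 \<pi> i\<close> times the difference of the sums of the zeros of \<open>\<Delta>\<close> and of \<open>\<Phi>\<close> in the disc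
  (\<open>zero_sum_log_ratio\<close>); the same formula without weight shows that the disc contains exactly \<open>N\<close>
  zeros of \<open>\<Delta>\<close>, and since eigenvalues are numbered by modulus these are the first \<open>N\<close> of them
  (\<open>sum_enumerated_zeros\<close>). By the residue theorem, the second one is \<open>-2 \<pi> i\<close> times the \<open>N\<close>-th
  partial sum of the \<open>s\<^sub>n\<close> (\<open>green_num_residue\<close>). So the partial sums of the two series differ by
  a null sequence, which is the assertion (\<open>spectral_partial_sums\<close>).
\<close>

section \<open>The Riemann--Lebesgue lemma for bounded kernels\<close>

text \<open>
  A Riemann--Lebesgue lemma in which oscillation enters only through the integrals of the kernels
  over half-lines, which generate the Borel sets and are closed under intersection. The sets over
  which the integrals of the kernels tend to zero form a Dynkin system, because the kernels are
  uniformly bounded and live on a common interval; hence all Borel sets belong to it. The functions with the asserted property are closed under sums and under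
  limits in \<open>L\<^sub>1\<close>.
\<close>

lemma Riemann_Lebesgue_kernel:
  fixes K :: "'i \<Rightarrow> real \<Rightarrow> complex" and f :: "real \<Rightarrow> complex"
  assumes meas: "\<And>i. K i \<in> borel_measurable lebesgue"
    and bound: "\<And>i t. norm (K i t) \<le> indicat_real {u..v} t"
    and cumul: "\<And>x. ((\<lambda>i. LINT t|lebesgue. indicat_real {..x} t *\<^sub>R K i t) \<longlongrightarrow> 0) F"
    and f: "integrable lebesgue f"
  shows "((\<lambda>i. LINT t|lebesgue. K i t * f t) \<longlongrightarrow> 0) F"
proof -
  have ind: "integrable lebesgue (indicat_real {u..v})"
    by (rule integrable_real_indicator) (auto simp: emeasure_lborel_Icc_eq)
  have K_int: "integrable lebesgue (K i)" for i
    by (rule Bochner_Integration.integrable_bound[OF ind meas]) (use bound in \<open>auto intro!: AE_I2\<close>)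
  have K_le1: "norm (K i t) \<le> 1" for i t
    by (rule order_trans[OF bound indicator_le_1])
  have Kg_int: "integrable lebesgue (\<lambda>t. K i t * g t)" if g: "integrable lebesgue g" for i g
  proof (rule Bochner_Integration.integrable_bound[OF g])
    show "(\<lambda>t. K i t * g t) \<in> borel_measurable lebesgue"
      using meas[of i] g by measurable
    have "norm (K i t * g t) \<le> norm (g t)" for t
      using mult_right_mono[OF K_le1[of i t], of "norm (g t)"] by (simp add: norm_mult)
    then show "AE t in lebesgue. norm (K i t * g t) \<le> norm (g t)" by (intro AE_I2)
  qed
  have KA_int: "integrable lebesgue (\<lambda>t. indicat_real A t *\<^sub>R K i t)" if "A \<in> sets lebesgue" for i A
    using integrable_mult_indicator[OF that K_int] .
  have borel: "((\<lambda>i. LINT t|lebesgue. indicat_real A t *\<^sub>R K i t) \<longlongrightarrow> 0) F"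
    if A: "A \<in> sets borel" for A
  proof -
    have gen: "A \<in> sigma_sets UNIV (range (\<lambda>a::real. {..a}))"
      using A unfolding borel_eq_atMost by simp
    have sets: "B \<in> sets lebesgue" if "B \<in> sigma_sets UNIV (range (\<lambda>a::real. {..a}))" for B
    proof -
      have "B \<in> sets (borel :: real measure)"
        using that unfolding borel_eq_atMost by simp
      then show ?thesis by simp
    qed
    have stable: "Int_stable (range (\<lambda>a::real. {..a}))"
      by (auto simp: Int_stable_def)
    have closed: "range (\<lambda>a::real. {..a}) \<subseteq> Pow UNIV" by simp
    from stable closed gen show ?thesis
    proof (induction rule: sigma_sets_induct_disjoint)
      case (basic A)
      then show ?case using cumul by auto
    next
      case empty
      then show ?case by simp
    next
      case (compl A)
      have whole: "(LINT t|lebesgue. K i t) = (LINT t|lebesgue. indicat_real {..v} t *\<^sub>R K i t)" for i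
      proof (rule Bochner_Integration.integral_cong)
        show "K i t = indicat_real {..v} t *\<^sub>R K i t" for t
          using bound[of i t] by (auto simp: indicator_def split: if_splits)
      qed simp
      have "(LINT t|lebesgue. indicat_real (UNIV - A) t *\<^sub>R K i t)
          = (LINT t|lebesgue. indicat_real {..v} t *\<^sub>R K i t) - (LINT t|lebesgue. indicat_real A t *\<^sub>R K i t)" for i
      proof -
        have "(LINT t|lebesgue. indicat_real (UNIV - A) t *\<^sub>R K i t)
            = (LINT t|lebesgue. K i t - indicat_real A t *\<^sub>R K i t)"
          by (rule Bochner_Integration.integral_cong) (auto simp: indicator_def)
        also have "\<dots> = (LINT t|lebesgue. K i t) - (LINT t|lebesgue. indicat_real A t *\<^sub>R K i t)"
          by (rule Bochner_Integration.integral_diff[OF K_int KA_int[OF sets[OF compl(1)]]])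
        finally show ?thesis unfolding whole .
      qed
      then show ?case
        using tendsto_diff[OF cumul[of v] compl(2)] by simp
    next
      case (union A)
      have As: "A n \<in> sets lebesgue" for n using union(2) sets by auto
      \<comment> \<open>The tail beyond the first n sets has small measure, and this controls all kernels at once.\<close>
      define B where "B n = (\<Union>i. A i) \<inter> {u..v} - (\<Union>i<n. A i)" for n
      have Bs: "B n \<in> sets lebesgue" for n
        unfolding B_def using As by (intro sets.Diff sets.Int sets.countable_UN sets.finite_UN) auto
      have B_lim: "(\<lambda>n. LINT t|lebesgue. indicat_real (B n) t) \<longlonglongrightarrow> (LINT t::real|lebesgue. 0)"
      proof (rule integral_dominated_convergence[OF _ _ ind])
        show "AE t in lebesgue. (\<lambda>n. indicat_real (B n) t) \<longlonglongrightarrow> 0"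
        proof (intro AE_I2)
          fix t :: real
          show "(\<lambda>n. indicat_real (B n) t) \<longlonglongrightarrow> 0"
          proof (cases "t \<in> (\<Union>i. A i)")
            case True
            then obtain m where m: "t \<in> A m" by auto
            have "\<forall>\<^sub>F n in sequentially. indicat_real (B n) t = 0"
              using eventually_gt_at_top[of m]
              by eventually_elim (use m in \<open>auto simp: B_def indicator_def\<close>)
            then show ?thesis by (rule tendsto_eventually)
          qed (auto simp: B_def indicator_def)
        qed
        show "AE t in lebesgue. norm (indicat_real (B n) t) \<le> indicat_real {u..v} t" for n
          by (intro AE_I2) (auto simp: B_def indicator_def)
        show "indicat_real (B n) \<in> borel_measurable lebesgue" for n using Bs by simp
      qed simp
      have B_int: "integrable lebesgue (indicat_real (B n))" for n
      proof (rule Bochner_Integration.integrable_bound[OF ind])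
        show "AE t in lebesgue. norm (indicat_real (B n) t) \<le> norm (indicat_real {u..v} t)"
          by (intro AE_I2) (auto simp: B_def indicator_def)
        show "indicat_real (B n) \<in> borel_measurable lebesgue" using Bs by simp
      qed
      show ?case
      proof (rule tendstoI)
        fix e :: real assume e: "0 < e"
        have "\<forall>\<^sub>F n in sequentially. dist (LINT t|lebesgue. indicat_real (B n) t) 0 < e/2"
          using B_lim e by (intro tendstoD) auto
        then obtain n where n: "dist (LINT t|lebesgue. indicat_real (B n) t) 0 < e/2"
          using eventually_happens by force
        have "((\<lambda>i. \<Sum>k<n. LINT t|lebesgue. indicat_real (A k) t *\<^sub>R K i t) \<longlongrightarrow> (\<Sum>k<n. 0)) F"
          using union(3) by (intro tendsto_sum) auto
        then have "\<forall>\<^sub>F i in F. dist (\<Sum>k<n. LINT t|lebesgue. indicat_real (A k) t *\<^sub>R K i t) 0 < e/2"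
          using e by (intro tendstoD) auto
        then show "\<forall>\<^sub>F i in F. dist (LINT t|lebesgue. indicat_real (\<Union>k. A k) t *\<^sub>R K i t) 0 < e"
        proof eventually_elim
          case (elim i)
          have split: "indicat_real (\<Union>k. A k) t *\<^sub>R K i t
              = (\<Sum>k<n. indicat_real (A k) t *\<^sub>R K i t) + indicat_real (B n) t *\<^sub>R K i t" for t
          proof -
            have "(\<Sum>k<n. indicat_real (A k) t) = indicat_real (\<Union>k<n. A k) t"
              using union(1) by (intro indicator_UN_disjoint[symmetric])
                (auto simp: disjoint_family_on_def)
            then have "(\<Sum>k<n. indicat_real (A k) t *\<^sub>R K i t) = indicat_real (\<Union>k<n. A k) t *\<^sub>R K i t"
              by (simp add: scaleR_sum_left[symmetric])
            moreover have "K i t = 0" if "t \<notin> {u..v}" using bound[of i t] that by simp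
            ultimately show ?thesis by (auto simp: B_def indicator_def)
          qed
          have "(LINT t|lebesgue. indicat_real (\<Union>k. A k) t *\<^sub>R K i t)
             = (\<Sum>k<n. LINT t|lebesgue. indicat_real (A k) t *\<^sub>R K i t)
               + (LINT t|lebesgue. indicat_real (B n) t *\<^sub>R K i t)"
            unfolding split
            by (simp only: Bochner_Integration.integral_add[OF Bochner_Integration.integrable_sum[OF KA_int[OF As]] KA_int[OF Bs]]
                  Bochner_Integration.integral_sum[OF KA_int[OF As]])
          moreover have "norm (LINT t|lebesgue. indicat_real (B n) t *\<^sub>R K i t)
              \<le> (LINT t|lebesgue. indicat_real (B n) t)"
          proof (rule Bochner_Integration.integral_norm_bound_integral[OF KA_int[OF Bs] B_int])
            show "norm (indicat_real (B n) t *\<^sub>R K i t) \<le> indicat_real (B n) t" for t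
              using K_le1[of i t] by (auto simp: indicator_def)
          qed
          ultimately show ?case using elim n
            by (simp add: dist_norm) (smt (verit) norm_triangle_ineq)
        qed
      qed
    qed
  qed
  from f show ?thesis
  proof (induction rule: integrable_induct)
    case (base A c)
    \<comment> \<open>A Lebesgue set differs from a Borel set by a null set.\<close>
    from base(1) obtain S N N' where A: "A = S \<union> N" "N \<subseteq> N'" "N' \<in> null_sets lborel" "S \<in> sets lborel"
      by (rule sets_completionE)
    have "AE t in lebesgue. t \<notin> N'"
      using A(3) null_sets_completionI AE_not_in by blast
    then have "(LINT t|lebesgue. K i t * (indicat_real A t *\<^sub>R c)) = (LINT t|lebesgue. (indicat_real S t *\<^sub>R K i t) * c)" for i
    proof (intro integral_cong_AE)
      show "(\<lambda>t. K i t * (indicat_real A t *\<^sub>R c)) \<in> borel_measurable lebesgue"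
        using meas[of i] base(1) by measurable
      show "(\<lambda>t. (indicat_real S t *\<^sub>R K i t) * c) \<in> borel_measurable lebesgue"
        by (intro borel_measurable_times borel_measurable_integrable[OF KA_int]) (use A(4) in simp_all)
    qed (use A in \<open>auto simp: indicator_def elim!: eventually_mono\<close>)
    moreover have "S \<in> sets borel" using A(4) by simp
    ultimately show ?case
      using tendsto_mult_left_zero[OF borel[of S], of c]
      by (simp del: mult_scaleR_left mult_scaleR_right)
  next
    case (add f g)
    have "(LINT t|lebesgue. K i t * (f t + g t)) = (LINT t|lebesgue. K i t * f t) + (LINT t|lebesgue. K i t * g t)" for i
      using Kg_int[OF add.hyps(1)] Kg_int[OF add.hyps(2)] by (simp add: distrib_left)
    then show ?case using tendsto_add[OF add.IH] by simp
  next
    case (lim f s)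
    have "(\<lambda>n. LINT t|lebesgue. norm (s n t - f t)) \<longlonglongrightarrow> (LINT t::real|lebesgue. 0)"
    proof (rule integral_dominated_convergence)
      show "integrable lebesgue (\<lambda>t. 3 * norm (f t))" using lim.hyps(4) by simp
      show "AE t in lebesgue. (\<lambda>n. norm (s n t - f t)) \<longlonglongrightarrow> 0"
        using lim.hyps(2) by (intro AE_I2) (metis (no_types) LIM_zero tendsto_norm_zero space_completion space_lborel UNIV_I)
      show "AE t in lebesgue. norm (norm (s n t - f t)) \<le> 3 * norm (f t)" for n
      proof (intro AE_I2)
        fix t show "norm (norm (s n t - f t)) \<le> 3 * norm (f t)"
          using lim.hyps(3)[of t n] norm_triangle_ineq4[of "s n t" "f t"] by simp
      qed
      show "(\<lambda>t. norm (s n t - f t)) \<in> borel_measurable lebesgue" for n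
        using lim.hyps(1)[of n] lim.hyps(4) by measurable
    qed simp
    then have L1: "(\<lambda>n. LINT t|lebesgue. norm (s n t - f t)) \<longlonglongrightarrow> 0" by simp
    show ?case
    proof (rule tendstoI)
      fix e :: real assume e: "0 < e"
      have "\<forall>\<^sub>F n in sequentially. dist (LINT t|lebesgue. norm (s n t - f t)) 0 < e/2"
        using L1 e by (intro tendstoD) auto
      then obtain n where n: "dist (LINT t|lebesgue. norm (s n t - f t)) 0 < e/2"
        using eventually_happens by force
      have "\<forall>\<^sub>F i in F. dist (LINT t|lebesgue. K i t * s n t) 0 < e/2"
        using lim.IH e by (intro tendstoD) auto
      then show "\<forall>\<^sub>F i in F. dist (LINT t|lebesgue. K i t * f t) 0 < e"
      proof eventually_elim
        case (elim i)
        have d: "integrable lebesgue (\<lambda>t. s n t - f t)" using lim.hyps(1,4) by simp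
        have "norm ((LINT t|lebesgue. K i t * s n t) - (LINT t|lebesgue. K i t * f t))
            = norm (LINT t|lebesgue. K i t * (s n t - f t))"
          using Kg_int[OF lim.hyps(1)] Kg_int[OF lim.hyps(4)] by (simp add: right_diff_distrib)
        also have "\<dots> \<le> (LINT t|lebesgue. norm (s n t - f t))"
        proof (rule Bochner_Integration.integral_norm_bound_integral[OF Kg_int[OF d]])
          show "norm (K i t * (s n t - f t)) \<le> norm (s n t - f t)" for t
            using mult_right_mono[OF K_le1[of i t], of "norm (s n t - f t)"] by (simp add: norm_mult)
        qed (use d in simp)
        finally show ?case using elim n
          by (simp add: dist_norm) (smt (verit) norm_triangle_sub norm_minus_commute)
      qed
    qed
  qed
qed

section \<open>Holomorphy in the spectral parameter\<close>

text \<open>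
  An even entire function of \<open>\<rho>\<close> is an entire function of \<open>\<rho>\<^sup>2\<close>. The branch cut of the square root
  is harmless: near the negative axis the other branch \<open>\<i> * csqrt (- z)\<close> is holomorphic and gives the
  same values, and at the origin the singularity is removable.
\<close>

lemma holomorphic_even_comp_csqrt:
  assumes f: "f holomorphic_on UNIV" and even: "\<And>z. f (- z) = f z"
  shows "(\<lambda>z. f (csqrt z)) holomorphic_on UNIV"
proof (rule no_isolated_singularity'[of "{0}"])
  let ?h = "\<lambda>z. f (csqrt z)"
  have cont: "isCont f z" for z
    using holomorphic_on_imp_continuous_on[OF f] by (simp add: continuous_on_eq_continuous_at)
  have right: "?h field_differentiable at z" if "z \<notin> \<real>\<^sub>\<le>\<^sub>0" for z
  proof -
    have "csqrt field_differentiable at z"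
      using that by (rule field_differentiable_at_csqrt)
    moreover have "f field_differentiable at (csqrt z)"
      using f by (simp add: holomorphic_on_def)
    ultimately show ?thesis
      using field_differentiable_compose[of csqrt z f] by (simp add: o_def)
  qed
  have left: "?h field_differentiable at z" if "- z \<notin> \<real>\<^sub>\<le>\<^sub>0" for z
  proof -
    have h_eq: "?h w = f (\<i> * csqrt (- w))" for w
    proof -
      have "(csqrt w)\<^sup>2 = (\<i> * csqrt (- w))\<^sup>2" by (simp add: power_mult_distrib)
      then have "csqrt w = \<i> * csqrt (- w) \<or> csqrt w = - (\<i> * csqrt (- w))"
        by (simp only: power2_eq_iff)
      then show ?thesis using even by metis
    qed
    have 1: "(\<lambda>w. - w) field_differentiable at z"
      by (intro derivative_intros)
    have "csqrt field_differentiable at (- z)"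
      using that by (rule field_differentiable_at_csqrt)
    then have "(\<lambda>w. csqrt (- w)) field_differentiable at z"
      using field_differentiable_compose[OF 1] by (simp add: o_def)
    then have "(\<lambda>w. \<i> * csqrt (- w)) field_differentiable at z"
      by (intro derivative_intros)
    moreover have "f field_differentiable at (\<i> * csqrt (- z))"
      using f by (simp add: holomorphic_on_def)
    ultimately have "(\<lambda>w. f (\<i> * csqrt (- w))) field_differentiable at z"
      using field_differentiable_compose[of "\<lambda>w. \<i> * csqrt (- w)" z f] by (simp add: o_def)
    then show ?thesis unfolding h_eq .
  qed
  show "?h holomorphic_on UNIV - {0}"
    unfolding holomorphic_on_def
  proof (intro ballI)
    fix z :: complex assume z: "z \<in> UNIV - {0}"
    have "z \<notin> \<real>\<^sub>\<le>\<^sub>0 \<or> - z \<notin> \<real>\<^sub>\<le>\<^sub>0"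
      using z by (auto simp: complex_nonpos_Reals_iff complex_eq_iff)
    then show "?h field_differentiable at z within UNIV - {0}"
      using left right field_differentiable_at_within by blast
  qed
  show "(?h \<longlongrightarrow> ?h z) (at z within UNIV)" if "z \<in> {0}" for z
  proof -
    have "(csqrt \<longlongrightarrow> 0) (at 0)"
    proof (rule Lim_null_comparison)
      show "\<forall>\<^sub>F w in at 0. norm (csqrt w) \<le> sqrt (norm w)" by (simp add: norm_csqrt)
      have "((\<lambda>w::complex. sqrt (norm w)) \<longlongrightarrow> sqrt (norm (0::complex))) (at 0)"
        by (intro tendsto_intros)
      then show "((\<lambda>w::complex. sqrt (norm w)) \<longlongrightarrow> 0) (at 0)" by simp
    qed
    then show ?thesis using that cont[of 0] isCont_tendsto_compose[of 0 f csqrt "at 0"] by simp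
  qed
qed auto

lemma sin_quot_sums:
  "(\<lambda>n. of_real (sin_coeff (Suc n)) * \<rho> ^ n * of_real y ^ Suc n) sums sin_quot \<rho> y"
proof (cases "\<rho> = 0")
  case True
  have "(\<lambda>n. of_real (sin_coeff (Suc n)) * (0::complex) ^ n * of_real y ^ Suc n)
      sums (of_real (sin_coeff (Suc 0)) * 0 ^ 0 * of_real y ^ Suc 0)"
    using sums_finite[of "{0}" "\<lambda>n. of_real (sin_coeff (Suc n)) * (0::complex) ^ n * of_real y ^ Suc n"]
    by auto
  then show ?thesis using True by (simp add: sin_quot_def sin_coeff_def)
next
  case False
  have "(\<lambda>n. sin_coeff n *\<^sub>R (\<rho> * of_real y) ^ n) sums sin (\<rho> * of_real y)"
    by (rule sin_converges)
  then have "(\<lambda>n. sin_coeff (Suc n) *\<^sub>R (\<rho> * of_real y) ^ Suc n) sums sin (\<rho> * of_real y)"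
    using sums_Suc_iff[of "\<lambda>n. sin_coeff n *\<^sub>R (\<rho> * of_real y) ^ n"] by simp
  then have "(\<lambda>n. sin_coeff (Suc n) *\<^sub>R (\<rho> * of_real y) ^ Suc n / \<rho>) sums (sin (\<rho> * of_real y) / \<rho>)"
    by (rule sums_divide)
  then show ?thesis using False
    by (simp add: sin_quot_def scaleR_conv_of_real power_mult_distrib mult_ac)
qed

text \<open>
  Uniformity in both variables allows integration of the power series against an \<open>L\<^sub>1\<close> weight.
\<close>

lemma sin_quot_uniform_limit:
  "uniform_limit (cball 0 r \<times> {- L..L})
     (\<lambda>n (\<rho>, y). \<Sum>k<n. of_real (sin_coeff (Suc k)) * \<rho> ^ k * of_real y ^ Suc k)
     (\<lambda>(\<rho>, y). sin_quot \<rho> y) sequentially"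
proof (cases "r \<ge> 0 \<and> L \<ge> 0")
  case True
  then have r: "r \<ge> 0" and L: "L \<ge> 0" by auto
  let ?t = "\<lambda>k (\<rho>::complex, y::real). complex_of_real (sin_coeff (Suc k)) * \<rho> ^ k * of_real y ^ Suc k"
  have "uniform_limit (cball 0 r \<times> {- L..L}) (\<lambda>n z. \<Sum>k<n. ?t k z) (\<lambda>z. suminf (\<lambda>k. ?t k z)) sequentially"
  proof (rule Weierstrass_m_test)
    show "norm (?t k z) \<le> L * inverse (fact k) * (r * L) ^ k" if "z \<in> cball 0 r \<times> {- L..L}" for k z
    proof -
      obtain \<rho> y where z: "z = (\<rho>, y)" by force
      have le: "norm \<rho> \<le> r" "\<bar>y\<bar> \<le> L" using that z by auto
      have "\<bar>sin_coeff (Suc k)\<bar> \<le> inverse (fact k)"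
      proof -
        have "\<bar>sin_coeff (Suc k)\<bar> \<le> inverse (fact (Suc k))"
          by (auto simp: sin_coeff_def abs_mult power_abs field_simps)
        also have "\<dots> \<le> inverse (fact k)"
          by (intro le_imp_inverse_le fact_mono) auto
        finally show ?thesis .
      qed
      then have "\<bar>sin_coeff (Suc k)\<bar> * norm \<rho> ^ k * \<bar>y\<bar> ^ Suc k \<le> inverse (fact k) * r ^ k * L ^ Suc k"
        using le r L by (intro mult_mono power_mono) auto
      then show ?thesis unfolding z
        by (simp add: norm_mult norm_power power_mult_distrib mult_ac)
    qed
    have "summable (\<lambda>k. L * (inverse (fact k) * (r * L) ^ k))"
      by (intro summable_mult summable_exp)
    then show "summable (\<lambda>k. L * inverse (fact k) * (r * L) ^ k)" by (simp add: mult.assoc)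
  qed
  then show ?thesis
    using sums_unique[OF sin_quot_sums] by (simp add: case_prod_beta')
qed (auto simp: uniform_limit_iff)

lemma sin_quot_entire: "(\<lambda>\<rho>. sin_quot \<rho> y) holomorphic_on UNIV"
proof (rule holomorphic_uniform_sequence)
  show "(\<lambda>\<rho>. \<Sum>k<n. of_real (sin_coeff (Suc k)) * \<rho> ^ k * of_real y ^ Suc k) holomorphic_on UNIV" for n
    by (intro holomorphic_intros)
  fix c :: complex
  have "uniform_limit (cball c 1)
     (\<lambda>n \<rho>. \<Sum>k<n. of_real (sin_coeff (Suc k)) * \<rho> ^ k * of_real y ^ Suc k)
     (\<lambda>\<rho>. sin_quot \<rho> y) sequentially"
  proof (rule uniform_limitI)
    fix e :: real assume "0 < e"
    have sub: "(\<rho>, y) \<in> cball 0 (norm c + 1) \<times> {- \<bar>y\<bar>..\<bar>y\<bar>}" if "\<rho> \<in> cball c 1" for \<rho>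
      using that norm_triangle_sub[of \<rho> c] by (auto simp: dist_norm norm_minus_commute)
    show "\<forall>\<^sub>F n in sequentially. \<forall>\<rho>\<in>cball c 1.
        dist (\<Sum>k<n. of_real (sin_coeff (Suc k)) * \<rho> ^ k * of_real y ^ Suc k) (sin_quot \<rho> y) < e"
      using uniform_limitD[OF sin_quot_uniform_limit[of "norm c + 1" "\<bar>y\<bar>"] \<open>0 < e\<close>]
      by eventually_elim (use sub in fastforce)
  qed
  then show "\<exists>d>0. cball c d \<subseteq> UNIV \<and> uniform_limit (cball c d)
     (\<lambda>n \<rho>. \<Sum>k<n. of_real (sin_coeff (Suc k)) * \<rho> ^ k * of_real y ^ Suc k)
     (\<lambda>\<rho>. sin_quot \<rho> y) sequentially"
    by (intro exI[of _ 1]) auto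
qed simp

lemma absolutely_integrable_continuous_mult:
  fixes f g :: "real \<Rightarrow> complex"
  assumes "continuous_on {u..v} g" and "f absolutely_integrable_on {u..v}"
  shows "(\<lambda>t. g t * f t) absolutely_integrable_on {u..v}"
proof (rule absolutely_integrable_bounded_measurable_product[where h = "(*)"])
  show "bilinear ((*) :: complex \<Rightarrow> _)" by (rule bilinear_times)
  show "g \<in> borel_measurable (lebesgue_on {u..v})"
    using assms(1) by (intro continuous_imp_measurable_on_sets_lebesgue) auto
  show "bounded (g ` {u..v})"
    using assms(1) by (intro compact_imp_bounded compact_continuous_image) auto
qed (use assms in auto)

lemma norm_set_integral_mult_le:
  fixes f g :: "real \<Rightarrow> complex"
  assumes g: "continuous_on {u..v} g" and f: "f absolutely_integrable_on {u..v}"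
    and B: "\<And>t. t \<in> {u..v} \<Longrightarrow> norm (g t) \<le> B"
  shows "norm (LINT t:{u..v}|lebesgue. g t * f t) \<le> B * (LINT t:{u..v}|lebesgue. norm (f t))"
proof -
  have nf: "set_integrable lebesgue {u..v} (\<lambda>t. norm (f t))"
    using f by (rule set_integrable_norm)
  have gf: "set_integrable lebesgue {u..v} (\<lambda>t. g t * f t)"
    by (rule absolutely_integrable_continuous_mult[OF g f])
  have "norm (LINT t:{u..v}|lebesgue. g t * f t) \<le> (LINT t:{u..v}|lebesgue. norm (g t * f t))"
    by (rule set_integral_norm_bound[OF gf])
  also have "\<dots> \<le> (LINT t:{u..v}|lebesgue. B * norm (f t))"
    using B by (intro set_integral_mono set_integrable_norm[OF gf] set_integrable_mult_right[OF nf])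
      (auto simp: norm_mult intro!: mult_right_mono)
  also have "\<dots> = B * (LINT t:{u..v}|lebesgue. norm (f t))"
    by (rule set_integral_mult_right)
  finally show ?thesis .
qed

lemma continuous_sin_quot: "continuous_on S (\<lambda>t. sin_quot \<rho> (x - t))"
  unfolding sin_quot_def by (cases "\<rho> = 0") (auto intro!: continuous_intros)

text \<open>
  The Taylor polynomials of the kernel in \<open>\<rho>\<close> turn the integral into polynomials whose coefficients
  are moments of \<open>f\<close>, and these converge locally uniformly.
\<close>

lemma sin_conv_entire:
  assumes f: "f absolutely_integrable_on {0..x}"
  shows "(\<lambda>\<rho>. sin_conv f \<rho> x) holomorphic_on UNIV"
proof (rule holomorphic_uniform_sequence)
  define P where "P n \<rho> t = (\<Sum>k<n. of_real (sin_coeff (Suc k)) * \<rho> ^ k * of_real (x - t) ^ Suc k)"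
    for n and \<rho> :: complex and t
  let ?F = "\<lambda>n \<rho>. LINT t:{0..x}|lebesgue. P n \<rho> t * f t"
  define I where "I k = (LINT t:{0..x}|lebesgue. of_real (x - t) ^ Suc k * f t)" for k
  have moment: "set_integrable lebesgue {0..x} (\<lambda>t. of_real (x - t) ^ Suc k * f t)" for k
    by (rule absolutely_integrable_continuous_mult[OF _ f]) (intro continuous_intros)
  have "?F n \<rho> = (\<Sum>k<n. of_real (sin_coeff (Suc k)) * \<rho> ^ k * I k)" for n \<rho>
  proof -
    have "?F n \<rho> = (LINT t:{0..x}|lebesgue.
        (\<Sum>k<n. of_real (sin_coeff (Suc k)) * \<rho> ^ k * (of_real (x - t) ^ Suc k * f t)))"
      by (simp only: P_def sum_distrib_right mult.assoc)
    also have "\<dots> = (\<Sum>k<n. LINT t:{0..x}|lebesgue.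
        of_real (sin_coeff (Suc k)) * \<rho> ^ k * (of_real (x - t) ^ Suc k * f t))"
      using set_integrable_mult_right[OF moment] unfolding set_lebesgue_integral_def scaleR_sum_right
      by (intro Bochner_Integration.integral_sum) (simp add: set_integrable_def)
    also have "\<dots> = (\<Sum>k<n. of_real (sin_coeff (Suc k)) * \<rho> ^ k * I k)"
      unfolding I_def by (intro sum.cong refl set_integral_mult_right)
    finally show ?thesis .
  qed
  then show "?F n holomorphic_on UNIV" for n
    by (simp only:) (intro holomorphic_intros)
  fix c :: complex
  define L where "L = (LINT t:{0..x}|lebesgue. norm (f t))"
  have L: "0 \<le> L" unfolding L_def set_lebesgue_integral_def
    by (intro Bochner_Integration.integral_nonneg) auto
  have "uniform_limit (cball c 1) ?F (\<lambda>\<rho>. sin_conv f \<rho> x) sequentially"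
  proof (rule uniform_limitI)
    fix e :: real assume e: "0 < e"
    then have e': "0 < e / (2 * (L + 1))" using L by simp
    have sub: "(\<rho>, x - t) \<in> cball 0 (norm c + 1) \<times> {- \<bar>x\<bar>..\<bar>x\<bar>}"
      if "\<rho> \<in> cball c 1" "t \<in> {0..x}" for \<rho> t
      using that norm_triangle_sub[of \<rho> c] by (auto simp: dist_norm norm_minus_commute)
    have contP: "continuous_on {0..x} (P n \<rho>)" for n \<rho>
      unfolding P_def by (intro continuous_intros)
    show "\<forall>\<^sub>F n in sequentially. \<forall>\<rho>\<in>cball c 1. dist (?F n \<rho>) (sin_conv f \<rho> x) < e"
      using uniform_limitD[OF sin_quot_uniform_limit[of "norm c + 1" "\<bar>x\<bar>"] e']
    proof eventually_elim
      case (elim n)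
      show ?case
      proof
        fix \<rho> assume \<rho>: "\<rho> \<in> cball c 1"
        have "dist (?F n \<rho>) (sin_conv f \<rho> x)
            = norm (LINT t:{0..x}|lebesgue. (P n \<rho> t - sin_quot \<rho> (x - t)) * f t)"
          unfolding dist_norm sin_conv_def left_diff_distrib
          by (subst set_integral_diff)
             (auto intro!: absolutely_integrable_continuous_mult contP f continuous_sin_quot)
        also have "\<dots> \<le> e / (2 * (L + 1)) * L"
          unfolding L_def
        proof (rule norm_set_integral_mult_le[OF _ f])
          show "norm (P n \<rho> t - sin_quot \<rho> (x - t)) \<le> e / (2 * ((LINT t:{0..x}|lebesgue. norm (f t)) + 1))"
            if "t \<in> {0..x}" for t
            using less_imp_le[OF bspec[OF elim sub[OF \<rho> that]]] unfolding P_def L_def dist_norm by simp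
        qed (intro continuous_intros contP continuous_sin_quot)
        also have "\<dots> < e" using e L by (simp add: field_simps add_nonneg_pos)
        finally show "dist (?F n \<rho>) (sin_conv f \<rho> x) < e" .
      qed
    qed
  qed
  then show "\<exists>d>0. cball c d \<subseteq> UNIV \<and> uniform_limit (cball c d) ?F (\<lambda>\<rho>. sin_conv f \<rho> x) sequentially"
    by (intro exI[of _ 1]) auto
qed simp

section \<open>The Green function of the unperturbed problem on large circles\<close>

text \<open>
  The unperturbed solution without its factor \<open>1/\<rho>\<close> (\<open>j = 0\<close>), so that both boundary conditions can
  be treated at once.
\<close>

definition trig :: "nat \<Rightarrow> complex \<Rightarrow> complex" where
  "trig j w = (if j = 0 then sin w else cos w)"

lemma norm_trig_le: "norm (trig j w) \<le> exp \<bar>Im w\<bar>"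
  using cmod_sin_le_exp[of 1 w] cmod_cos_le_exp[of 1 w] by (simp add: trig_def)

lemma norm_trig_le_exp:
  assumes "\<bar>y\<bar> \<le> L"
  shows "norm (trig j (\<rho> * of_real y)) \<le> exp (\<bar>Im \<rho>\<bar> * L)"
proof -
  have "norm (trig j (\<rho> * of_real y)) \<le> exp (\<bar>Im \<rho>\<bar> * \<bar>y\<bar>)"
    using norm_trig_le[of j "\<rho> * of_real y"] by (simp add: abs_mult)
  also have "\<dots> \<le> exp (\<bar>Im \<rho>\<bar> * L)"
    using assms by (simp add: mult_left_mono)
  finally show ?thesis .
qed

lemma phi_eq_trig: "j \<in> {0, 1} \<Longrightarrow> \<rho> \<noteq> 0 \<Longrightarrow> \<rho> ^ (1 - j) * phi j \<rho> x = trig j (\<rho> * of_real x)"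
  by (auto simp: phi_def trig_def sin_quot_def)

lemma continuous_trig: "continuous_on S (\<lambda>t. trig j (\<rho> * of_real (\<alpha> + \<epsilon> * t)))"
  unfolding trig_def by (cases "j = 0") (auto intro!: continuous_intros)

lemma norm_integral_trig_le:
  fixes \<rho> :: complex and \<alpha> \<epsilon> :: real
  assumes \<rho>: "\<rho> \<noteq> 0" and \<epsilon>: "\<bar>\<epsilon>\<bar> = 1"
    and L: "\<And>t. t \<in> {u..v} \<Longrightarrow> \<bar>\<alpha> + \<epsilon> * t\<bar> \<le> L"
  shows "norm (LINT t:{u..v}|lebesgue. trig j (\<rho> * of_real (\<alpha> + \<epsilon> * t)))
      \<le> 2 * exp (\<bar>Im \<rho>\<bar> * L) / norm \<rho>"
proof (cases "u \<le> v")
  case True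
  define U where "U t = (if j = 0 then - trig 1 (\<rho> * of_real (\<alpha> + \<epsilon> * t))
      else trig 0 (\<rho> * of_real (\<alpha> + \<epsilon> * t))) / (\<rho> * of_real \<epsilon>)" for t
  have \<epsilon>0: "\<epsilon> \<noteq> 0" using \<epsilon> by auto
  have deriv: "(U has_vector_derivative trig j (\<rho> * of_real (\<alpha> + \<epsilon> * t))) (at t within {u..v})" for t
  proof -
    define V where "V z = (if j = 0 then - trig 1 (\<rho> * (of_real \<alpha> + of_real \<epsilon> * z))
      else trig 0 (\<rho> * (of_real \<alpha> + of_real \<epsilon> * z))) / (\<rho> * of_real \<epsilon>)" for z
    have "(V has_field_derivative trig j (\<rho> * of_real (\<alpha> + \<epsilon> * t))) (at (of_real t))"
    proof -
      have D: "((\<lambda>z. \<rho> * (of_real \<alpha> + of_real \<epsilon> * z)) has_field_derivative (\<rho> * of_real \<epsilon>)) (at (of_real t))"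
        by (auto intro!: derivative_eq_intros)
      show ?thesis
        using DERIV_cdivide[OF DERIV_minus[OF DERIV_chain2[OF DERIV_cos D]], of "\<rho> * of_real \<epsilon>"]
          DERIV_cdivide[OF DERIV_chain2[OF DERIV_sin D], of "\<rho> * of_real \<epsilon>"] \<rho> \<epsilon>0
        by (cases "j = 0") (simp_all add: V_def[abs_def] trig_def)
    qed
    then have "((\<lambda>t. V (of_real t)) has_vector_derivative trig j (\<rho> * of_real (\<alpha> + \<epsilon> * t))) (at t within {u..v})"
      by (rule has_vector_derivative_real_field)
    moreover have "(\<lambda>t. V (of_real t)) = U" by (auto simp: U_def V_def)
    ultimately show ?thesis by simp
  qed
  have "((\<lambda>t. trig j (\<rho> * of_real (\<alpha> + \<epsilon> * t))) has_integral (U v - U u)) {u..v}"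
    using deriv True by (intro fundamental_theorem_of_calculus) auto
  moreover have "(\<lambda>t. trig j (\<rho> * of_real (\<alpha> + \<epsilon> * t))) absolutely_integrable_on {u..v}"
    by (intro absolutely_integrable_continuous_real continuous_trig)
  ultimately have eq: "(LINT t:{u..v}|lebesgue. trig j (\<rho> * of_real (\<alpha> + \<epsilon> * t))) = U v - U u"
    by (metis set_lebesgue_integral_eq_integral(2) integral_unique)
  have "norm (U t) \<le> exp (\<bar>Im \<rho>\<bar> * L) / norm \<rho>" if "t \<in> {u..v}" for t
    using norm_trig_le_exp[OF L[OF that], of 1 \<rho>] norm_trig_le_exp[OF L[OF that], of 0 \<rho>] \<epsilon>
    by (auto simp: U_def norm_divide norm_mult intro!: divide_right_mono)
  from this[of u] this[of v] True show ?thesis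
    unfolding eq using norm_triangle_ineq4[of "U v" "U u"] by auto
qed (auto simp: set_lebesgue_integral_def)

text \<open>
  For complex \<open>\<rho>\<close> the oscillating kernel grows exponentially; after division by its maximal size
  on the interval the abstract lemma applies, since the primitive gains a factor \<open>1/\<rho>\<close>.
\<close>

lemma Riemann_Lebesgue_trig:
  fixes f :: "real \<Rightarrow> complex" and \<alpha> \<epsilon> :: real
  assumes f: "f absolutely_integrable_on {u..v}" and \<epsilon>: "\<bar>\<epsilon>\<bar> = 1"
    and L: "\<And>t. t \<in> {u..v} \<Longrightarrow> \<bar>\<alpha> + \<epsilon> * t\<bar> \<le> L"
  shows "((\<lambda>\<rho>. of_real (exp (- (\<bar>Im \<rho>\<bar> * L))) *
      (LINT t:{u..v}|lebesgue. trig j (\<rho> * of_real (\<alpha> + \<epsilon> * t)) * f t)) \<longlongrightarrow> 0) at_infinity"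
proof -
  define E where "E \<rho> = exp (- (\<bar>Im \<rho>\<bar> * L))" for \<rho>
  define K where "K \<rho> t = indicat_real {u..v} t *\<^sub>R (of_real (E \<rho>) * trig j (\<rho> * of_real (\<alpha> + \<epsilon> * t)))" for \<rho> t
  have "((\<lambda>\<rho>. LINT t|lebesgue. K \<rho> t * (indicat_real {u..v} t *\<^sub>R f t)) \<longlongrightarrow> 0) at_infinity"
  proof (rule Riemann_Lebesgue_kernel)
    have meas: "(\<lambda>t. of_real (E \<rho>) * trig j (\<rho> * of_real (\<alpha> + \<epsilon> * t))) \<in> borel_measurable borel" for \<rho>
      by (intro borel_measurable_continuous_onI continuous_intros continuous_trig)
    show "K \<rho> \<in> borel_measurable lebesgue" for \<rho>
      unfolding K_def using meas[of \<rho>] by (intro measurable_completion) simp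
    show "norm (K \<rho> t) \<le> indicat_real {u..v} t" for \<rho> t
    proof (cases "t \<in> {u..v}")
      case True
      have "E \<rho> * norm (trig j (\<rho> * of_real (\<alpha> + \<epsilon> * t))) \<le> E \<rho> * exp (\<bar>Im \<rho>\<bar> * L)"
        by (intro mult_left_mono norm_trig_le_exp L True) (simp add: E_def)
      also have "\<dots> = 1" by (simp add: E_def exp_minus)
      finally show ?thesis using True by (simp add: K_def norm_mult E_def)
    qed (simp add: K_def)
    show "integrable lebesgue (\<lambda>t. indicat_real {u..v} t *\<^sub>R f t)"
      using f by (simp add: set_integrable_def)
    fix x :: real
    have int_eq: "(LINT t|lebesgue. indicat_real {..x} t *\<^sub>R K \<rho> t)
        = of_real (E \<rho>) * (LINT t:{u..min x v}|lebesgue. trig j (\<rho> * of_real (\<alpha> + \<epsilon> * t)))" for \<rho>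
      unfolding set_lebesgue_integral_def
      by (subst integral_mult_right_zero[symmetric], intro Bochner_Integration.integral_cong refl)
         (auto simp: K_def indicator_def)
    show "((\<lambda>\<rho>. LINT t|lebesgue. indicat_real {..x} t *\<^sub>R K \<rho> t) \<longlongrightarrow> 0) at_infinity"
      unfolding int_eq
    proof (rule Lim_null_comparison)
      have "\<forall>\<^sub>F \<rho>::complex in at_infinity. norm \<rho> \<ge> 1" by (auto simp: eventually_at_infinity)
      then show "\<forall>\<^sub>F \<rho> in at_infinity. norm (of_real (E \<rho>) *
          (LINT t:{u..min x v}|lebesgue. trig j (\<rho> * of_real (\<alpha> + \<epsilon> * t)))) \<le> 2 * inverse (norm \<rho>)"
      proof eventually_elim
        case (elim \<rho>)
        have "E \<rho> * norm (LINT t:{u..min x v}|lebesgue. trig j (\<rho> * of_real (\<alpha> + \<epsilon> * t)))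
            \<le> E \<rho> * (2 * exp (\<bar>Im \<rho>\<bar> * L) / norm \<rho>)"
          using elim by (intro mult_left_mono norm_integral_trig_le \<epsilon> L) (auto simp: E_def)
        also have "\<dots> = 2 * inverse (norm \<rho>)" by (simp add: E_def exp_minus field_simps)
        finally show ?case by (simp add: norm_mult E_def)
      qed
      have "((\<lambda>\<rho>::complex. 2 * inverse (norm \<rho>)) \<longlongrightarrow> 2 * 0) at_infinity"
        by (intro tendsto_intros tendsto_inverse_0_at_top filterlim_norm_at_top)
      then show "((\<lambda>\<rho>::complex. 2 * inverse (norm \<rho>)) \<longlongrightarrow> 0) at_infinity" by simp
    qed
  qed
  moreover have "(LINT t|lebesgue. K \<rho> t * (indicat_real {u..v} t *\<^sub>R f t))
      = of_real (exp (- (\<bar>Im \<rho>\<bar> * L))) * (LINT t:{u..v}|lebesgue. trig j (\<rho> * of_real (\<alpha> + \<epsilon> * t)) * f t)" for \<rho>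
    unfolding set_lebesgue_integral_def
    by (subst integral_mult_right_zero[symmetric], intro Bochner_Integration.integral_cong refl)
       (auto simp: K_def E_def indicator_def)
  ultimately show ?thesis by simp
qed

text \<open>
  The integral of \<open>f\<close> against the Green function of the unperturbed problem, with one argument frozen
  at \<open>c\<close>, is the quotient of this function by \<open>phi j \<rho> pi\<close>.
\<close>

definition green_num :: "nat \<Rightarrow> real \<Rightarrow> (real \<Rightarrow> complex) \<Rightarrow> complex \<Rightarrow> complex" where
  "green_num j c f \<rho> = phi j \<rho> c * sin_conv f \<rho> pi - sin_conv f \<rho> c * phi j \<rho> pi"

text \<open>
  This cancellation keeps \<open>green_num\<close> within the growth \<open>exp (\<bar>Im \<rho>\<bar> * pi)\<close>, whereas for \<open>t < c\<close> each
  term on the left alone is larger than that by an exponential factor.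
\<close>

lemma green_kernel:
  "phi j \<rho> c * sin_quot \<rho> (pi - t) - sin_quot \<rho> (c - t) * phi j \<rho> pi = sin_quot \<rho> (pi - c) * phi j \<rho> t"
proof (cases "\<rho> = 0")
  case False
  have sub: "sin_quot \<rho> (x - y)
      = (sin (\<rho> * of_real x) * cos (\<rho> * of_real y) - cos (\<rho> * of_real x) * sin (\<rho> * of_real y)) / \<rho>" for x y
    using False by (simp add: sin_quot_def right_diff_distrib sin_diff)
  show ?thesis
  proof (cases "j = 0")
    case True
    then show ?thesis using False unfolding sub
      by (simp add: phi_def sin_quot_def) (simp add: field_simps)
  next
    case False
    then show ?thesis unfolding sub using \<open>\<rho> \<noteq> 0\<close>
      by (simp add: phi_def) (simp add: field_simps)
  qed
qed (simp add: phi_def sin_quot_def algebra_simps)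

lemma set_integral_split_Icc:
  fixes f :: "real \<Rightarrow> complex"
  assumes "u \<le> c" "c \<le> v" and f: "f absolutely_integrable_on {u..v}"
  shows "(LINT t:{u..v}|lebesgue. f t) = (LINT t:{u..c}|lebesgue. f t) + (LINT t:{c..v}|lebesgue. f t)"
proof -
  have "f absolutely_integrable_on {u..c}" "f absolutely_integrable_on {c..v}"
    using assms by (auto intro: set_integrable_subset[OF f])
  then show ?thesis
    using assms Henstock_Kurzweil_Integration.integral_combine[of u c v f]
    by (simp add: set_lebesgue_integral_eq_integral)
qed

lemma green_num_eq:
  assumes c: "0 \<le> c" "c \<le> pi" and f: "f absolutely_integrable_on {0..pi}"
  shows "green_num j c f \<rho> = sin_quot \<rho> (pi - c) * (LINT t:{0..c}|lebesgue. phi j \<rho> t * f t)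
      + phi j \<rho> c * (LINT t:{c..pi}|lebesgue. sin_quot \<rho> (pi - t) * f t)"
proof -
  have f1: "f absolutely_integrable_on {0..c}"
    using c by (auto intro: set_integrable_subset[OF f])
  have i1: "set_integrable lebesgue {0..c} (\<lambda>t. sin_quot \<rho> (x - t) * f t)" for x
    by (rule absolutely_integrable_continuous_mult[OF continuous_sin_quot f1])
  have "sin_conv f \<rho> pi = (LINT t:{0..c}|lebesgue. sin_quot \<rho> (pi - t) * f t)
      + (LINT t:{c..pi}|lebesgue. sin_quot \<rho> (pi - t) * f t)"
    unfolding sin_conv_def
    by (rule set_integral_split_Icc[OF c absolutely_integrable_continuous_mult[OF continuous_sin_quot f]])
  moreover have "phi j \<rho> c * (LINT t:{0..c}|lebesgue. sin_quot \<rho> (pi - t) * f t) - phi j \<rho> pi * sin_conv f \<rho> c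
      = sin_quot \<rho> (pi - c) * (LINT t:{0..c}|lebesgue. phi j \<rho> t * f t)"
  proof -
    have "phi j \<rho> c * (LINT t:{0..c}|lebesgue. sin_quot \<rho> (pi - t) * f t) - phi j \<rho> pi * sin_conv f \<rho> c
      = (LINT t:{0..c}|lebesgue. phi j \<rho> c * (sin_quot \<rho> (pi - t) * f t) - phi j \<rho> pi * (sin_quot \<rho> (c - t) * f t))"
      unfolding sin_conv_def
      by (subst set_integral_diff(2)) (auto intro!: set_integrable_mult_right i1)
    also have "\<dots> = (LINT t:{0..c}|lebesgue. sin_quot \<rho> (pi - c) * (phi j \<rho> t * f t))"
    proof (rule arg_cong[where f = "set_lebesgue_integral lebesgue {0..c}"], rule ext)
      fix t
      show "phi j \<rho> c * (sin_quot \<rho> (pi - t) * f t) - phi j \<rho> pi * (sin_quot \<rho> (c - t) * f t)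
          = sin_quot \<rho> (pi - c) * (phi j \<rho> t * f t)"
        using arg_cong[OF green_kernel[of j \<rho> c t], of "\<lambda>z. z * f t"] by (simp add: algebra_simps)
    qed
    finally show ?thesis by simp
  qed
  ultimately show ?thesis by (simp add: green_num_def algebra_simps)
qed

text \<open>
  The growth rates on the two sides of \<open>c\<close> add up to \<open>\<bar>Im \<rho>\<bar> * pi\<close>.
\<close>

lemma green_num_little_o:
  assumes c: "0 \<le> c" "c \<le> pi" and f: "f absolutely_integrable_on {0..pi}" and j: "j \<in> {0, 1}"
  shows "((\<lambda>\<rho>. of_real (exp (- (\<bar>Im \<rho>\<bar> * pi))) * (\<rho> * \<rho> ^ (1 - j) * green_num j c f \<rho>)) \<longlongrightarrow> 0) at_infinity"
proof -
  define A where "A \<rho> = of_real (exp (- (\<bar>Im \<rho>\<bar> * c))) *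
      (LINT t:{0..c}|lebesgue. trig j (\<rho> * of_real (0 + 1 * t)) * f t)" for \<rho>
  define B where "B \<rho> = of_real (exp (- (\<bar>Im \<rho>\<bar> * (pi - c)))) *
      (LINT t:{c..pi}|lebesgue. trig 0 (\<rho> * of_real (pi + (-1) * t)) * f t)" for \<rho>
  have A: "(A \<longlongrightarrow> 0) at_infinity"
    unfolding A_def using c
    by (intro Riemann_Lebesgue_trig set_integrable_subset[OF f]) auto
  have B: "(B \<longlongrightarrow> 0) at_infinity"
    unfolding B_def using c
    by (intro Riemann_Lebesgue_trig set_integrable_subset[OF f]) auto
  show ?thesis
  proof (rule Lim_null_comparison)
    have "((\<lambda>\<rho>. norm (A \<rho>) + norm (B \<rho>)) \<longlongrightarrow> norm (0::complex) + norm (0::complex)) at_infinity"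
      using A B by (intro tendsto_intros)
    then show "((\<lambda>\<rho>. norm (A \<rho>) + norm (B \<rho>)) \<longlongrightarrow> 0) at_infinity" by simp
    have "\<forall>\<^sub>F \<rho>::complex in at_infinity. norm \<rho> \<ge> 1" by (auto simp: eventually_at_infinity)
    then show "\<forall>\<^sub>F \<rho> in at_infinity.
        norm (of_real (exp (- (\<bar>Im \<rho>\<bar> * pi))) * (\<rho> * \<rho> ^ (1 - j) * green_num j c f \<rho>)) \<le> norm (A \<rho>) + norm (B \<rho>)"
    proof eventually_elim
      case (elim \<rho>)
      then have \<rho>: "\<rho> \<noteq> 0" by auto
      define a where "a = exp (- (\<bar>Im \<rho>\<bar> * c))"
      define b where "b = exp (- (\<bar>Im \<rho>\<bar> * (pi - c)))"
      have ab: "exp (- (\<bar>Im \<rho>\<bar> * pi)) = a * b"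
        by (simp add: a_def b_def exp_add[symmetric] algebra_simps)
      define sa where "sa = of_real b * trig 0 (\<rho> * of_real (pi - c))"
      define sb where "sb = of_real a * trig j (\<rho> * of_real c)"
      have sa: "norm sa \<le> 1"
      proof -
        have "b * norm (trig 0 (\<rho> * of_real (pi - c))) \<le> b * exp (\<bar>Im \<rho>\<bar> * (pi - c))"
          using c by (intro mult_left_mono norm_trig_le_exp) (auto simp: b_def)
        also have "\<dots> = 1" by (simp add: b_def exp_minus)
        finally show ?thesis by (simp add: sa_def norm_mult b_def del: of_real_diff)
      qed
      have sb: "norm sb \<le> 1"
      proof -
        have "a * norm (trig j (\<rho> * of_real c)) \<le> a * exp (\<bar>Im \<rho>\<bar> * c)"
          using c by (intro mult_left_mono norm_trig_le_exp) (auto simp: a_def)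
        also have "\<dots> = 1" by (simp add: a_def exp_minus)
        finally show ?thesis by (simp add: sb_def norm_mult a_def)
      qed
      have s: "\<rho> * sin_quot \<rho> y = trig 0 (\<rho> * of_real y)" for y
        using \<rho> by (simp add: sin_quot_def trig_def)
      have e1: "\<rho> ^ (1 - j) * (LINT t:{0..c}|lebesgue. phi j \<rho> t * f t)
          = (LINT t:{0..c}|lebesgue. trig j (\<rho> * of_real (0 + 1 * t)) * f t)"
        using phi_eq_trig[OF j \<rho>]
        by (subst set_integral_mult_right[symmetric]) (simp add: mult.assoc[symmetric])
      have e2: "\<rho> * (LINT t:{c..pi}|lebesgue. sin_quot \<rho> (pi - t) * f t)
          = (LINT t:{c..pi}|lebesgue. trig 0 (\<rho> * of_real (pi + (-1) * t)) * f t)"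
        using s
        by (subst set_integral_mult_right[symmetric]) (simp add: mult.assoc[symmetric])
      have "of_real (exp (- (\<bar>Im \<rho>\<bar> * pi))) * (\<rho> * \<rho> ^ (1 - j) * green_num j c f \<rho>)
          = (of_real b * (\<rho> * sin_quot \<rho> (pi - c))) * (of_real a * (\<rho> ^ (1 - j) * (LINT t:{0..c}|lebesgue. phi j \<rho> t * f t)))
          + (of_real a * (\<rho> ^ (1 - j) * phi j \<rho> c)) * (of_real b * (\<rho> * (LINT t:{c..pi}|lebesgue. sin_quot \<rho> (pi - t) * f t)))"
        unfolding ab green_num_eq[OF c f] of_real_mult by (simp only: algebra_simps)
      also have "\<dots> = sa * A \<rho> + sb * B \<rho>"
        unfolding e1 e2 s phi_eq_trig[OF j \<rho>] sa_def sb_def A_def B_def a_def b_def ..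
      finally have eq: "of_real (exp (- (\<bar>Im \<rho>\<bar> * pi))) * (\<rho> * \<rho> ^ (1 - j) * green_num j c f \<rho>)
          = sa * A \<rho> + sb * B \<rho>" .
      have "norm (sa * A \<rho>) \<le> norm (A \<rho>)" "norm (sb * B \<rho>) \<le> norm (B \<rho>)"
        using mult_right_mono[OF sa, of "norm (A \<rho>)"] mult_right_mono[OF sb, of "norm (B \<rho>)"]
        by (simp_all add: norm_mult)
      then show ?case unfolding eq using norm_triangle_ineq[of "sa * A \<rho>" "sb * B \<rho>"] by linarith
    qed
  qed
qed

text \<open>
  Let \<open>\<rho> = \<sigma> + \<i> \<tau>\<close>. The square of the norm is \<open>(e\<^sup>2 + 1/e\<^sup>2 \<plusminus> 2 cos (2 \<pi> \<sigma>)) / 4\<close>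
  with \<open>e = exp (\<bar>\<tau>\<bar> \<pi>)\<close>. If \<open>\<bar>\<tau>\<bar> \<ge> 1/4\<close>, then the first term dominates. Otherwise \<open>\<bar>\<sigma>\<bar>\<close> is within
  \<open>1/16\<close> of the radius, which is half-way between two zeros, and the cosine term is nonnegative.
\<close>

lemma trig_lower_bound:
  assumes j: "j \<in> {0, 1}" and N: "1 \<le> N" and \<rho>: "norm \<rho> = real N + 1 / 2 - real j / 2"
  shows "exp (\<bar>Im \<rho>\<bar> * pi) \<le> 5 * norm (trig j (\<rho> * of_real pi))"
proof -
  define R where "R = real N + 1 / 2 - real j / 2"
  define E where "E = exp (\<bar>Im \<rho>\<bar> * pi)"
  define C where "C = (if j = 0 then - cos (2 * (Re \<rho> * pi)) else cos (2 * (Re \<rho> * pi)))"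
  have E0: "E > 0" by (simp add: E_def)
  have exp2: "exp (2 * (Im \<rho> * pi)) + inverse (exp (2 * (Im \<rho> * pi))) = E\<^sup>2 + inverse (E\<^sup>2)"
  proof (cases "Im \<rho> \<ge> 0")
    case True
    then have "E\<^sup>2 = exp (2 * (Im \<rho> * pi))" by (simp add: E_def exp_double)
    then show ?thesis by simp
  next
    case False
    then have "E\<^sup>2 = exp (- (2 * (Im \<rho> * pi)))" by (simp add: E_def exp_double[symmetric])
    then show ?thesis by (simp add: exp_minus)
  qed
  define J where "J = inverse (E\<^sup>2)"
  have J0: "J \<ge> 0" by (simp add: J_def)
  have norm2: "(norm (trig j (\<rho> * of_real pi)))\<^sup>2 = (E\<^sup>2 + J + 2 * C) / 4"
  proof -
    have "(exp (Im \<rho> * pi) - inverse (exp (Im \<rho> * pi)))\<^sup>2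
        = exp (2 * (Im \<rho> * pi)) + inverse (exp (2 * (Im \<rho> * pi))) - 2"
      by (simp add: exp_double power2_diff power_inverse)
    then show ?thesis
      using norm_sin_squared[of "\<rho> * of_real pi"] norm_cos_squared[of "\<rho> * of_real pi"] exp2
        cos_double_cos[of "Re \<rho> * pi"]
      by (simp add: trig_def C_def J_def)
  qed
  have "E\<^sup>2 \<le> 25 * (norm (trig j (\<rho> * of_real pi)))\<^sup>2"
  proof (cases "\<bar>Im \<rho>\<bar> \<ge> 1 / 4")
    case True
    have "5 / 2 \<le> 1 + (2::real) * (\<bar>Im \<rho>\<bar> * pi)"
      using mult_mono[OF True, of 3 pi] pi_gt3 by simp
    also have "\<dots> \<le> exp (2 * (\<bar>Im \<rho>\<bar> * pi))" by (rule exp_ge_add_one_self)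
    also have "\<dots> = E\<^sup>2" by (simp add: E_def exp_double)
    finally have "5 / 2 \<le> E\<^sup>2" .
    moreover have "C \<ge> -1" by (auto simp: C_def)
    ultimately show ?thesis unfolding norm2 using J0 by simp
  next
    case False
    define d where "d = R - \<bar>Re \<rho>\<bar>"
    have R1: "R \<ge> 1" using N j by (auto simp: R_def)
    have "\<bar>Re \<rho>\<bar> \<le> R" using abs_Re_le_cmod[of \<rho>] \<rho> by (simp add: R_def)
    then have d0: "0 \<le> d" by (simp add: d_def)
    have "R\<^sup>2 = (Re \<rho>)\<^sup>2 + (Im \<rho>)\<^sup>2" using \<rho> cmod_power2[of \<rho>] by (simp add: R_def)
    then have "d * (R + \<bar>Re \<rho>\<bar>) = \<bar>Im \<rho>\<bar>\<^sup>2"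
      by (simp add: d_def algebra_simps power2_eq_square)
    also have "\<dots> \<le> (1/4)\<^sup>2" using False by (intro power_mono) auto
    finally have "d * (R + \<bar>Re \<rho>\<bar>) \<le> 1 / 16" by (simp add: power2_eq_square)
    moreover have "d * 1 \<le> d * (R + \<bar>Re \<rho>\<bar>)" using d0 R1 by (intro mult_left_mono) auto
    ultimately have d1: "d \<le> 1 / 16" by simp
    have cd: "cos (2 * pi * d) \<ge> 0"
    proof (rule cos_ge_zero)
      have "2 * pi * d \<le> 2 * pi * (1/16)" using d1 by (intro mult_left_mono) auto
      then show "2 * pi * d \<le> pi / 2" using pi_gt_zero by linarith
      have "0 \<le> 2 * pi * d" using d0 by simp
      then show "- (pi / 2) \<le> 2 * pi * d" using pi_gt_zero by linarith
    qed
    have ce: "cos (2 * (Re \<rho> * pi)) = cos (2 * pi * R - 2 * pi * d)"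
    proof -
      have "2 * pi * R - 2 * pi * d = 2 * (\<bar>Re \<rho>\<bar> * pi)" by (simp add: d_def algebra_simps)
      then show ?thesis by (cases "Re \<rho> \<ge> 0") auto
    qed
    have "C = cos (2 * pi * d)"
    proof (cases "j = 0")
      case True
      have "2 * pi * R - 2 * pi * d = (pi - 2 * pi * d) + real N * (2 * pi)"
        using True by (simp add: R_def algebra_simps)
      then have "cos (2 * pi * R - 2 * pi * d) = cos (pi - 2 * pi * d)"
        by (simp only: cos.plus_of_nat[where 'a = real, unfolded of_real_eq_id id_apply])
      then show ?thesis using True ce by (simp add: C_def)
    next
      case False
      then have "2 * pi * R - 2 * pi * d = - (2 * pi * d) + real N * (2 * pi)"
        using j by (simp add: R_def algebra_simps)
      then have "cos (2 * pi * R - 2 * pi * d) = cos (- (2 * pi * d))"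
        by (simp only: cos.plus_of_nat[where 'a = real, unfolded of_real_eq_id id_apply])
      then show ?thesis using False ce by (simp add: C_def)
    qed
    then have "0 \<le> C" using cd by simp
    moreover have "E\<^sup>2 \<ge> 0" by simp
    ultimately show ?thesis unfolding norm2 using J0 by simp
  qed
  then have "E\<^sup>2 \<le> (5 * norm (trig j (\<rho> * of_real pi)))\<^sup>2" by (simp add: power_mult_distrib)
  then have "E \<le> 5 * norm (trig j (\<rho> * of_real pi))" by (rule power2_le_imp_le) simp
  then show ?thesis by (simp add: E_def)
qed

lemma green_quotient_small:
  assumes c: "0 \<le> c" "c \<le> pi" and f: "f absolutely_integrable_on {0..pi}" and j: "j \<in> {0, 1}"
    and \<delta>: "\<delta> > 0"
  shows "\<forall>\<^sub>F \<rho> in at_infinity. \<forall>N\<ge>1. norm \<rho> = real N + 1 / 2 - real j / 2 \<longrightarrow>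
      norm (green_num j c f \<rho> / phi j \<rho> pi) \<le> \<delta> / norm \<rho>"
proof -
  have 1: "\<forall>\<^sub>F \<rho> in at_infinity. dist (of_real (exp (- (\<bar>Im \<rho>\<bar> * pi))) * (\<rho> * \<rho> ^ (1 - j) * green_num j c f \<rho>)) 0 < \<delta> / 5"
    using green_num_little_o[OF c f j] \<delta> by (intro tendstoD) auto
  have 2: "\<forall>\<^sub>F \<rho>::complex in at_infinity. norm \<rho> \<ge> 1" by (auto simp: eventually_at_infinity)
  from 1 2 show ?thesis
  proof eventually_elim
    case (elim \<rho>)
    then have \<rho>: "\<rho> \<noteq> 0" by auto
    show ?case
    proof (intro allI impI)
      fix N :: nat assume N: "1 \<le> N" "norm \<rho> = real N + 1 / 2 - real j / 2"
      define T where "T = norm (trig j (\<rho> * of_real pi))"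
      define G where "G = norm (\<rho> ^ (1 - j) * green_num j c f \<rho>)"
      define E where "E = exp (\<bar>Im \<rho>\<bar> * pi)"
      have E0: "E > 0" by (simp add: E_def)
      have ET: "E \<le> 5 * T" unfolding E_def T_def by (rule trig_lower_bound[OF j N])
      then have T0: "T > 0" using E0 by linarith
      define e where "e = exp (- (\<bar>Im \<rho>\<bar> * pi))"
      have eE: "e * E = 1" by (simp add: e_def E_def exp_add[symmetric])
      have "norm (of_real e * (\<rho> * \<rho> ^ (1 - j) * green_num j c f \<rho>)) = e * (norm \<rho> * G)"
        by (simp add: G_def norm_mult e_def)
      then have "e * (norm \<rho> * G) < \<delta> / 5" using elim(1) by (simp add: e_def)
      then have "e * (norm \<rho> * G) * E < \<delta> / 5 * E" using E0 by (rule mult_strict_right_mono)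
      moreover have "e * (norm \<rho> * G) * E = norm \<rho> * G" using eE by (simp add: mult_ac)
      ultimately have "norm \<rho> * G < \<delta> / 5 * E" by simp
      also have "\<dots> \<le> \<delta> / 5 * (5 * T)" using ET \<delta> by (intro mult_left_mono) auto
      finally have "norm \<rho> * G \<le> \<delta> * T" by simp
      then have "G / T \<le> \<delta> / norm \<rho>" using T0 \<rho> by (simp add: field_simps)
      moreover have "norm (green_num j c f \<rho> / phi j \<rho> pi) = G / T"
      proof -
        have "green_num j c f \<rho> / phi j \<rho> pi = (\<rho> ^ (1 - j) * green_num j c f \<rho>) / (\<rho> ^ (1 - j) * phi j \<rho> pi)"
          using \<rho> by simp
        also have "\<dots> = (\<rho> ^ (1 - j) * green_num j c f \<rho>) / trig j (\<rho> * of_real pi)"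
          by (simp only: phi_eq_trig[OF j \<rho>])
        finally show ?thesis by (simp only: G_def T_def norm_divide)
      qed
      ultimately show "norm (green_num j c f \<rho> / phi j \<rho> pi) \<le> \<delta> / norm \<rho>"
        by simp
    qed
  qed
qed

section \<open>Zeros inside a circle under a small perturbation\<close>

lemma finite_zeros_cball:
  fixes f :: "complex \<Rightarrow> complex"
  assumes f: "f holomorphic_on UNIV" and w: "f w \<noteq> 0"
  shows "finite {z \<in> cball 0 r. f z = 0}"
proof (cases "f constant_on UNIV")
  case True
  then have "f z \<noteq> 0" for z using w by (auto simp: constant_on_def)
  then show ?thesis by simp
next
  case False
  then show ?thesis
    by (intro holomorphic_compact_finite_zeros[OF f]) auto
qed

lemma winding_number_circle_0:
  assumes "r > 0" "norm z \<noteq> r"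
  shows "winding_number (circlepath 0 r) z = (if norm z < r then 1 else 0)"
proof (cases "norm z < r")
  case True
  then show ?thesis by (simp add: winding_number_circlepath)
next
  case False
  then have "winding_number (circlepath 0 r) z = 0"
    using assms by (intro winding_number_zero_outside[where s = "cball 0 r"]) auto
  then show ?thesis using False by simp
qed

text \<open>
  The weighted form of the argument principle for a disc. The auxiliary radius \<open>r + 1\<close> confines the
  zeros to a bounded set, which makes them finite in number.
\<close>

lemma argument_principle_circle:
  assumes f: "f holomorphic_on UNIV" and h: "h holomorphic_on UNIV" and r: "r > 0"
    and nz: "\<And>z. norm z = r \<Longrightarrow> f z \<noteq> 0"
  shows "contour_integral (circlepath 0 r) (\<lambda>z. deriv f z * h z / f z)
    = 2 * pi * \<i> * (\<Sum>z | norm z < r \<and> f z = 0. h z * of_int (zorder f z))"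
proof -
  have nz': "f (of_real r) \<noteq> 0" using nz[of "of_real r"] r by simp
  have fin: "finite {z \<in> ball 0 (r + 1). f z = 0 \<or> z \<in> {}}"
    by (rule finite_subset[OF _ finite_zeros_cball[OF f nz', of "r + 1"]]) auto
  have out: "winding_number (circlepath 0 r) z = 0" if "z \<notin> ball 0 (r + 1)" for z
    using that r by (subst winding_number_circle_0) auto
  have "contour_integral (circlepath 0 r) (\<lambda>z. deriv f z * h z / f z) = 2 * pi * \<i> *
      (\<Sum>p\<in>{z \<in> ball 0 (r + 1). f z = 0 \<or> z \<in> {}}. winding_number (circlepath 0 r) p * h p * zorder f p)"
  proof (rule argument_principle)
    show "f holomorphic_on ball 0 (r + 1) - {}" "h holomorphic_on ball 0 (r + 1)"
      using f h by (auto intro: holomorphic_on_subset)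
    show "path_image (circlepath 0 r) \<subseteq> ball 0 (r + 1) - {z \<in> ball 0 (r + 1). f z = 0 \<or> z \<in> {}}"
      using r nz by (auto simp: path_image_circlepath_nonneg)
  qed (use fin out in auto)
  also have "(\<Sum>p\<in>{z \<in> ball 0 (r + 1). f z = 0 \<or> z \<in> {}}. winding_number (circlepath 0 r) p * h p * zorder f p)
      = (\<Sum>z | norm z < r \<and> f z = 0. h z * of_int (zorder f z))"
  proof (rule sum.mono_neutral_cong_right)
    show "finite {z \<in> ball 0 (r + 1). f z = 0 \<or> z \<in> {}}" by (rule fin)
    show "\<forall>p\<in>{z \<in> ball 0 (r + 1). f z = 0 \<or> z \<in> {}} - {z. norm z < r \<and> f z = 0}.
        winding_number (circlepath 0 r) p * h p * zorder f p = 0"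
    proof
      fix p assume p: "p \<in> {z \<in> ball 0 (r + 1). f z = 0 \<or> z \<in> {}} - {z. norm z < r \<and> f z = 0}"
      then have "norm p \<noteq> r" "\<not> norm p < r" using nz by auto
      then show "winding_number (circlepath 0 r) p * h p * zorder f p = 0"
        using r by (simp add: winding_number_circle_0)
    qed
    show "winding_number (circlepath 0 r) z * h z * zorder f z = h z * of_int (zorder f z)"
      if "z \<in> {z. norm z < r \<and> f z = 0}" for z
      using that r by (simp add: winding_number_circle_0)
  qed auto
  finally show ?thesis .
qed

lemma near_one_not_nonpos_Real:
  fixes z :: complex
  assumes "norm (z - 1) < 1"
  shows "z \<notin> \<real>\<^sub>\<le>\<^sub>0"
  using assms abs_Re_le_cmod[of "z - 1"] by (auto simp: complex_nonpos_Reals_iff)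

text \<open>
  Where \<open>f/g\<close> is close to \<open>1\<close>, the function \<open>h * Ln (f/g)\<close> is a single-valued primitive of
  \<open>h' Ln (f/g) + h (f'/f - g'/g)\<close>, so the integral of the latter over the closed circle vanishes;
  the argument principle evaluates its second part.
\<close>

lemma zero_sum_log_ratio:
  assumes f: "f holomorphic_on UNIV" and g: "g holomorphic_on UNIV" and h: "h holomorphic_on UNIV"
    and r: "r > 0"
    and nz: "\<And>z. norm z = r \<Longrightarrow> g z \<noteq> 0"
    and close: "\<And>z. norm z = r \<Longrightarrow> norm (f z / g z - 1) < 1"
  shows "(\<Sum>z | norm z < r \<and> f z = 0. h z * of_int (zorder f z))
       - (\<Sum>z | norm z < r \<and> g z = 0. h z * of_int (zorder g z))
     = - contour_integral (circlepath 0 r) (\<lambda>z. deriv h z * Ln (f z / g z)) / (2 * pi * \<i>)"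
proof -
  have ratio: "f z / g z \<notin> \<real>\<^sub>\<le>\<^sub>0" if "norm z = r" for z
    using close[OF that] by (rule near_one_not_nonpos_Real)
  have nzf: "f z \<noteq> 0" if "norm z = r" for z using ratio[OF that] by auto
  have circ: "path_image (circlepath 0 r) = {z. norm z = r}"
    using r by (auto simp: path_image_circlepath_nonneg)
  have der: "(u has_field_derivative deriv u z) (at z)" if "u holomorphic_on UNIV" for u :: "complex \<Rightarrow> complex" and z
    using holomorphic_derivI[OF that, of z] by simp
  have cont: "continuous_on {z. norm z = r} u" if "u holomorphic_on UNIV" for u
    using that by (meson holomorphic_on_imp_continuous_on continuous_on_subset subset_UNIV)
  have cont': "continuous_on {z. norm z = r} (deriv u)" if "u holomorphic_on UNIV" for u
    using that by (intro cont holomorphic_deriv) auto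
  let ?A = "\<lambda>z. deriv f z * h z / f z" and ?B = "\<lambda>z. deriv g z * h z / g z"
    and ?C = "\<lambda>z. deriv h z * Ln (f z / g z)"
  have iA: "?A contour_integrable_on circlepath 0 r"
    by (intro contour_integrable_continuous_circlepath)
       (unfold circ, intro continuous_intros cont cont' f h, use nzf in auto)
  have iB: "?B contour_integrable_on circlepath 0 r"
    by (intro contour_integrable_continuous_circlepath)
       (unfold circ, intro continuous_intros cont cont' g h, use nz in auto)
  have iC: "?C contour_integrable_on circlepath 0 r"
    by (intro contour_integrable_continuous_circlepath)
       (unfold circ, intro continuous_intros cont cont' f g h, use nz ratio in auto)
  have "((\<lambda>z. ?C z + (?A z - ?B z)) has_contour_integral
      (h (pathfinish (circlepath 0 r)) * Ln (f (pathfinish (circlepath 0 r)) / g (pathfinish (circlepath 0 r)))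
       - h (pathstart (circlepath 0 r)) * Ln (f (pathstart (circlepath 0 r)) / g (pathstart (circlepath 0 r)))))
      (circlepath 0 r)"
  proof (rule contour_integral_primitive[where S = "{z. norm z = r}"])
    fix z :: complex assume "z \<in> {z. norm z = r}"
    then have z: "norm z = r" by simp
    have D: "((\<lambda>w. f w / g w) has_field_derivative (deriv f z * g z - f z * deriv g z) / (g z * g z)) (at z)"
      using nz[OF z] by (intro DERIV_divide der f g)
    have "((\<lambda>w. Ln (f w / g w)) has_field_derivative
        1 / (f z / g z) * ((deriv f z * g z - f z * deriv g z) / (g z * g z))) (at z)"
      using DERIV_chain2[OF has_field_derivative_Ln[OF ratio[OF z]] D] by (simp add: divide_inverse)
    from DERIV_mult[OF der[OF h] this]
    have "((\<lambda>w. h w * Ln (f w / g w)) has_field_derivative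
        deriv h z * Ln (f z / g z) + 1 / (f z / g z) * ((deriv f z * g z - f z * deriv g z) / (g z * g z)) * h z) (at z)" .
    moreover have "1 / (f z / g z) * ((deriv f z * g z - f z * deriv g z) / (g z * g z)) * h z = ?A z - ?B z"
      using nz[OF z] nzf[OF z] by (simp add: field_simps)
    ultimately show "((\<lambda>w. h w * Ln (f w / g w)) has_field_derivative ?C z + (?A z - ?B z)) (at z within {z. norm z = r})"
      using has_field_derivative_at_within by simp
  qed (use circ in auto)
  then have "contour_integral (circlepath 0 r) (\<lambda>z. ?C z + (?A z - ?B z)) = 0"
    by (intro contour_integral_unique) simp
  then have "contour_integral (circlepath 0 r) ?A - contour_integral (circlepath 0 r) ?B
      = - contour_integral (circlepath 0 r) ?C"
    using contour_integral_add[OF iC contour_integrable_diff[OF iA iB]] contour_integral_diff[OF iA iB]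
    by (simp add: add_eq_0_iff)
  moreover have "contour_integral (circlepath 0 r) ?A
      = 2 * pi * \<i> * (\<Sum>z | norm z < r \<and> f z = 0. h z * of_int (zorder f z))"
    using nzf by (intro argument_principle_circle f h r)
  moreover have "contour_integral (circlepath 0 r) ?B
      = 2 * pi * \<i> * (\<Sum>z | norm z < r \<and> g z = 0. h z * of_int (zorder g z))"
    using nz by (intro argument_principle_circle g h r)
  ultimately have eq: "2 * pi * \<i> * ((\<Sum>z | norm z < r \<and> f z = 0. h z * of_int (zorder f z))
       - (\<Sum>z | norm z < r \<and> g z = 0. h z * of_int (zorder g z))) = - contour_integral (circlepath 0 r) ?C"
    by (simp only: right_diff_distrib)
  have cancel: "c \<noteq> 0 \<Longrightarrow> c * x = y \<Longrightarrow> x = y / c" for c x y :: complex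
    by (simp add: nonzero_eq_divide_eq mult.commute)
  show ?thesis by (rule cancel[OF _ eq]) simp
qed

lemma zorder_simple_zero:
  fixes g :: "complex \<Rightarrow> complex"
  assumes "g holomorphic_on UNIV" "g z = 0" "deriv g z \<noteq> 0"
  shows "zorder g z = 1"
  using assms by (intro zorder_zero_eqI[of g UNIV]) auto

text \<open>
  The hypotheses allow \<open>u\<close> to vanish at zeros of \<open>g\<close>, so the singularities need not be poles; for
  this reason the residue is computed as a limit.
\<close>

lemma residue_theorem_simple_zeros:
  assumes u: "u holomorphic_on UNIV" and g: "g holomorphic_on UNIV" and r: "r > 0"
    and nz: "\<And>z. norm z = r \<Longrightarrow> g z \<noteq> 0"
    and simple: "\<And>z. norm z < r \<Longrightarrow> g z = 0 \<Longrightarrow> deriv g z \<noteq> 0"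
  shows "contour_integral (circlepath 0 r) (\<lambda>z. u z / g z)
    = 2 * pi * \<i> * (\<Sum>z | norm z < r \<and> g z = 0. u z / deriv g z)"
proof -
  let ?Z = "{z \<in> ball 0 (r + 1). g z = 0}"
  have nz': "g (of_real r) \<noteq> 0" using nz[of "of_real r"] r by simp
  have fin: "finite ?Z"
    by (rule finite_subset[OF _ finite_zeros_cball[OF g nz', of "r + 1"]]) auto
  have holo: "(\<lambda>z. u z / g z) holomorphic_on ball 0 (r + 1) - ?Z"
    by (intro holomorphic_on_divide holomorphic_on_subset[OF u] holomorphic_on_subset[OF g]) auto
  have res: "residue (\<lambda>z. u z / g z) z = u z / deriv g z" if z: "norm z < r" "g z = 0" for z
  proof (rule residue_simple'[of "ball 0 (r + 1) - (?Z - {z})"])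
    show "open (ball 0 (r + 1) - (?Z - {z}))"
      using fin by (intro open_Diff finite_imp_closed) auto
    show "z \<in> ball 0 (r + 1) - (?Z - {z})" using z by auto
    show "(\<lambda>z. u z / g z) holomorphic_on ball 0 (r + 1) - (?Z - {z}) - {z}"
      by (rule holomorphic_on_subset[OF holo]) auto
    have "(g has_field_derivative deriv g z) (at z)"
      using holomorphic_derivI[OF g, of z] by simp
    then have "((\<lambda>w. (g w - g z) / (w - z)) \<longlongrightarrow> deriv g z) (at z)"
      by (simp add: has_field_derivative_iff)
    moreover have "(u \<longlongrightarrow> u z) (at z)"
      using holomorphic_on_imp_continuous_on[OF u] by (simp add: continuous_on_eq_continuous_at isCont_def)
    ultimately have "((\<lambda>w. u w / ((g w - g z) / (w - z))) \<longlongrightarrow> u z / deriv g z) (at z)"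
      using simple[OF z] by (intro tendsto_divide) auto
    then show "((\<lambda>w. u w / g w * (w - z)) \<longlongrightarrow> u z / deriv g z) (at z)"
      using z by simp
  qed
  have "contour_integral (circlepath 0 r) (\<lambda>z. u z / g z)
      = 2 * pi * \<i> * (\<Sum>p\<in>?Z. winding_number (circlepath 0 r) p * residue (\<lambda>z. u z / g z) p)"
  proof (rule Residue_theorem[OF _ _ fin holo])
    show "path_image (circlepath 0 r) \<subseteq> ball 0 (r + 1) - ?Z"
      using r nz by (auto simp: path_image_circlepath_nonneg)
    show "\<forall>z. z \<notin> ball 0 (r + 1) \<longrightarrow> winding_number (circlepath 0 r) z = 0"
      using r by (auto simp: winding_number_circle_0)
  qed auto
  also have "(\<Sum>p\<in>?Z. winding_number (circlepath 0 r) p * residue (\<lambda>z. u z / g z) p)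
      = (\<Sum>z | norm z < r \<and> g z = 0. u z / deriv g z)"
  proof (rule sum.mono_neutral_cong_right[OF fin])
    show "\<forall>p\<in>?Z - {z. norm z < r \<and> g z = 0}. winding_number (circlepath 0 r) p * residue (\<lambda>z. u z / g z) p = 0"
    proof
      fix p assume p: "p \<in> ?Z - {z. norm z < r \<and> g z = 0}"
      then have "norm p \<noteq> r" "\<not> norm p < r" using nz by auto
      then show "winding_number (circlepath 0 r) p * residue (\<lambda>z. u z / g z) p = 0"
        using r by (simp add: winding_number_circle_0)
    qed
    show "winding_number (circlepath 0 r) z * residue (\<lambda>z. u z / g z) z = u z / deriv g z"
      if "z \<in> {z. norm z < r \<and> g z = 0}" for z
      using that r by (simp add: winding_number_circle_0 res)
  qed auto
  finally show ?thesis .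
qed

text \<open>
  First-order perturbation of zeros: with multiplicities, \<open>f\<close> and \<open>g\<close> have equally many zeros, and
  their sum is shifted by \<open>- u/g'\<close> at each zero of \<open>g\<close>, with an error governed by how well \<open>u/g\<close> approximates
  \<open>Ln (f/g)\<close> on the circle. The claims use
  \<open>zero_sum_log_ratio\<close> with \<open>h = 1\<close> and with \<open>h z = z\<close>, respectively.
\<close>

lemma zero_sum_perturbation:
  assumes f: "f holomorphic_on UNIV" and g: "g holomorphic_on UNIV" and u: "u holomorphic_on UNIV"
    and r: "r > 0"
    and nz: "\<And>z. norm z = r \<Longrightarrow> g z \<noteq> 0"
    and simple: "\<And>z. norm z < r \<Longrightarrow> g z = 0 \<Longrightarrow> deriv g z \<noteq> 0"
    and close: "\<And>z. norm z = r \<Longrightarrow> norm (f z / g z - 1) < 1"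
    and B: "0 \<le> B" "\<And>z. norm z = r \<Longrightarrow> norm (Ln (f z / g z) - u z / g z) \<le> B"
  shows "(\<Sum>z | norm z < r \<and> f z = 0. of_int (zorder f z)) = (of_nat (card {z. norm z < r \<and> g z = 0}) :: complex)"
    and "norm ((\<Sum>z | norm z < r \<and> f z = 0. z * of_int (zorder f z))
       - (\<Sum>z | norm z < r \<and> g z = 0. z) + (\<Sum>z | norm z < r \<and> g z = 0. u z / deriv g z)) \<le> r * B"
proof -
  have zg: "zorder g z = 1" if "norm z < r" "g z = 0" for z
    using that simple by (intro zorder_simple_zero g) auto
  have one: "(\<lambda>_::complex. 1::complex) holomorphic_on UNIV" by simp
  have id: "(\<lambda>z::complex. z) holomorphic_on UNIV" by simp
  have "contour_integral (circlepath 0 r) (\<lambda>z. 0) = 0"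
    by (simp add: contour_integral_unique has_contour_integral_0)
  then show "(\<Sum>z | norm z < r \<and> f z = 0. of_int (zorder f z)) = (of_nat (card {z. norm z < r \<and> g z = 0}) :: complex)"
    using zero_sum_log_ratio[OF f g one r nz close] by (simp add: zg)
  have circ: "path_image (circlepath 0 r) = {z. norm z = r}"
    using r by (auto simp: path_image_circlepath_nonneg)
  have ratio: "f z / g z \<notin> \<real>\<^sub>\<le>\<^sub>0" if "norm z = r" for z
    using close[OF that] by (rule near_one_not_nonpos_Real)
  have cont: "continuous_on {z. norm z = r} v" if "v holomorphic_on UNIV" for v :: "complex \<Rightarrow> complex"
    using that by (meson holomorphic_on_imp_continuous_on continuous_on_subset subset_UNIV)
  have iL: "(\<lambda>z. Ln (f z / g z)) contour_integrable_on circlepath 0 r"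
    by (intro contour_integrable_continuous_circlepath)
       (unfold circ, intro continuous_intros cont f g, use nz ratio in auto)
  have iU: "(\<lambda>z. u z / g z) contour_integrable_on circlepath 0 r"
    by (intro contour_integrable_continuous_circlepath)
       (unfold circ, intro continuous_intros cont u g, use nz in auto)
  let ?L = "contour_integral (circlepath 0 r) (\<lambda>z. Ln (f z / g z))"
    and ?U = "contour_integral (circlepath 0 r) (\<lambda>z. u z / g z)"
  have L: "(\<Sum>z | norm z < r \<and> f z = 0. z * of_int (zorder f z)) - (\<Sum>z | norm z < r \<and> g z = 0. z)
      = - ?L / (2 * pi * \<i>)"
    using zero_sum_log_ratio[OF f g id r nz close] by (simp add: zg)
  have "?U = 2 * pi * \<i> * (\<Sum>z | norm z < r \<and> g z = 0. u z / deriv g z)"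
    using nz simple by (intro residue_theorem_simple_zeros u g r)
  then have U: "(\<Sum>z | norm z < r \<and> g z = 0. u z / deriv g z) = ?U / (2 * pi * \<i>)"
    by simp
  have "((\<lambda>z. Ln (f z / g z) - u z / g z) has_contour_integral (?L - ?U)) (circlepath 0 r)"
    using iL iU by (intro has_contour_integral_diff has_contour_integral_integral)
  then have "norm (?L - ?U) \<le> B * (2 * pi * r)"
    using B r by (intro has_contour_integral_bound_circlepath[of "\<lambda>z. Ln (f z / g z) - u z / g z" _ 0]) auto
  then have "norm (?L - ?U) / (2 * pi) \<le> r * B"
    by (simp add: field_simps)
  moreover have "norm (- ?L / (2 * pi * \<i>) + ?U / (2 * pi * \<i>)) = norm (?L - ?U) / (2 * pi)"
  proof -
    have "- ?L / (2 * pi * \<i>) + ?U / (2 * pi * \<i>) = - (?L - ?U) / (2 * pi * \<i>)"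
      by (simp add: diff_divide_distrib add_divide_distrib)
    then show ?thesis by (simp only: norm_divide norm_minus_cancel) (simp add: norm_mult)
  qed
  ultimately show "norm ((\<Sum>z | norm z < r \<and> f z = 0. z * of_int (zorder f z))
       - (\<Sum>z | norm z < r \<and> g z = 0. z) + (\<Sum>z | norm z < r \<and> g z = 0. u z / deriv g z)) \<le> r * B"
    unfolding L U by simp
qed

text \<open>
  For a small 2-by-2 matrix \<open>M\<close> the logarithm of \<open>det (I + M)\<close> is the trace up to a quadratic
  error. Here \<open>\<bar>D - 1\<bar> \<le> 4 * \<eta>\<close>, so the remainder of the logarithm contributes at most
  \<open>2 * (4 * \<eta>)\<^sup>2\<close>, and \<open>det M\<close> contributes \<open>2 * \<eta>\<^sup>2\<close>.
\<close>

lemma norm_Ln_det2_minus_trace_le: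
  fixes x y z w :: complex
  assumes \<eta>: "norm x \<le> \<eta>" "norm y \<le> \<eta>" "norm z \<le> \<eta>" "norm w \<le> \<eta>" "\<eta> \<le> 1 / 8"
  defines "D \<equiv> (1 + x) * (1 + w) - y * z"
  shows "norm (D - 1) \<le> 1 / 2" and "norm (Ln D - (x + w)) \<le> 34 * \<eta>\<^sup>2"
proof -
  have \<eta>0: "0 \<le> \<eta>" using \<eta>(1) norm_ge_zero order_trans by blast
  have quad: "norm (x * w - y * z) \<le> 2 * \<eta>\<^sup>2"
  proof -
    have "norm (x * w - y * z) \<le> norm x * norm w + norm y * norm z"
      using norm_triangle_ineq4[of "x * w" "y * z"] by (simp add: norm_mult)
    also have "\<dots> \<le> \<eta> * \<eta> + \<eta> * \<eta>" using \<eta> \<eta>0 by (intro add_mono mult_mono) auto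
    finally show ?thesis by (simp add: power2_eq_square)
  qed
  have D: "D - 1 = (x + w) + (x * w - y * z)" by (simp add: D_def algebra_simps)
  have "\<eta>\<^sup>2 \<le> \<eta>" using \<eta>(5) \<eta>0 mult_left_mono[of \<eta> 1 \<eta>] by (simp add: power2_eq_square)
  then have d: "norm (D - 1) \<le> 4 * \<eta>"
    unfolding D using norm_triangle_ineq[of "x + w" "x * w - y * z"] norm_triangle_ineq[of x w] quad \<eta>
    by linarith
  then show half: "norm (D - 1) \<le> 1 / 2" using \<eta>(5) by linarith
  have "norm (Ln D - (D - 1)) \<le> (norm (D - 1))\<^sup>2 / (1 - norm (D - 1))"
    using Ln_approx_linear[of "D - 1"] half by simp
  also have "\<dots> \<le> (4 * \<eta>)\<^sup>2 / (1 / 2)"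
    using d half by (intro frac_le power_mono) auto
  finally have lin: "norm (Ln D - (D - 1)) \<le> 32 * \<eta>\<^sup>2" by (simp add: power_mult_distrib)
  have eq: "Ln D - (x + w) = (Ln D - (D - 1)) + (x * w - y * z)" using D by simp
  show "norm (Ln D - (x + w)) \<le> 34 * \<eta>\<^sup>2"
    unfolding eq using norm_triangle_ineq[of "Ln D - (D - 1)" "x * w - y * z"] lin quad by linarith
qed

section \<open>The characteristic function as a perturbation determinant\<close>

lemma phi_minus: "phi j (- \<rho>) x = phi j \<rho> x"
  by (simp add: phi_def sin_quot_minus)

lemma sin_conv_minus: "sin_conv f (- \<rho>) x = sin_conv f \<rho> x"
  by (simp add: sin_conv_def sin_quot_minus)

lemma phi_entire: "(\<lambda>\<rho>. phi j \<rho> x) holomorphic_on UNIV"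
  unfolding phi_def using sin_quot_entire by (cases "j = 0") (auto intro!: holomorphic_intros)

lemma green_num_csqrt_entire:
  assumes c: "0 \<le> c" "c \<le> pi" and f: "f absolutely_integrable_on {0..pi}"
  shows "(\<lambda>z. green_num j c f (csqrt z)) holomorphic_on UNIV"
proof (rule holomorphic_even_comp_csqrt)
  have "f absolutely_integrable_on {0..c}"
    using c by (auto intro: set_integrable_subset[OF f])
  then show "green_num j c f holomorphic_on UNIV"
    unfolding green_num_def[abs_def] using f by (intro holomorphic_intros phi_entire sin_conv_entire)
qed (simp add: green_num_def phi_minus sin_conv_minus)

lemma phi_csqrt_entire: "(\<lambda>z. phi j (csqrt z) x) holomorphic_on UNIV"
  by (rule holomorphic_even_comp_csqrt[OF phi_entire phi_minus])

lemma char_det_eq: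
  "char_det j a b p q \<rho> =
     phi j \<rho> pi * ((sin_conv p \<rho> a - 1) * (sin_conv q \<rho> b - 1) - sin_conv q \<rho> a * sin_conv p \<rho> b)
     - sin_conv p \<rho> pi * (phi j \<rho> a * (sin_conv q \<rho> b - 1) - sin_conv q \<rho> a * phi j \<rho> b)
     + sin_conv q \<rho> pi * (phi j \<rho> a * sin_conv p \<rho> b - (sin_conv p \<rho> a - 1) * phi j \<rho> b)"
  by (simp add: char_det_def det_3 algebra_simps)

text \<open>
  Eliminating the first column with the pivot \<open>phi j \<rho> pi\<close> leaves the determinant of the 2-by-2
  matrix \<open>I + M\<close>, up to powers of the pivot; multiplied out, this is an identity of polynomials.
\<close>

lemma char_det_green:
  "char_det j a b p q \<rho> * phi j \<rho> pi =
     (phi j \<rho> pi + green_num j a p \<rho>) * (phi j \<rho> pi + green_num j b q \<rho>)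
     - green_num j a q \<rho> * green_num j b p \<rho>"
  unfolding char_det_eq green_num_def by algebra

lemma char_fun_entire:
  assumes "0 \<le> a" "a \<le> pi" "0 \<le> b" "b \<le> pi"
    and "p absolutely_integrable_on {0..pi}" "q absolutely_integrable_on {0..pi}"
  shows "char_fun j a b p q holomorphic_on UNIV"
proof -
  have s: "(\<lambda>\<rho>. sin_conv f \<rho> x) holomorphic_on UNIV"
    if "f absolutely_integrable_on {0..pi}" "0 \<le> x" "x \<le> pi" for f x
  proof (rule sin_conv_entire)
    show "f absolutely_integrable_on {0..x}"
      using that by (auto intro: set_integrable_subset[OF that(1)])
  qed
  have "char_det j a b p q holomorphic_on UNIV"
    unfolding char_det_eq[abs_def] using assms by (intro holomorphic_intros phi_entire s) auto
  then show ?thesis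
    unfolding char_fun_def[abs_def] by (intro holomorphic_even_comp_csqrt char_det_minus)
qed

section \<open>Unperturbed eigenvalues and residues\<close>

text \<open>
  The square roots of the unperturbed eigenvalues.
\<close>

definition free_root :: "nat \<Rightarrow> nat \<Rightarrow> real" where
  "free_root j n = real n - real j / 2"

lemma phi_csqrt_eq_0_iff:
  assumes j: "j \<in> {0, 1}"
  shows "phi j (csqrt z) pi = 0 \<longleftrightarrow> (\<exists>n\<ge>1. z = of_real ((free_root j n)\<^sup>2))"
proof
  assume z: "phi j (csqrt z) pi = 0"
  show "\<exists>n\<ge>1. z = of_real ((free_root j n)\<^sup>2)"
  proof (cases "j = 0")
    case True
    have z0: "csqrt z \<noteq> 0" using z True by (auto simp: phi_def sin_quot_def)
    then have "sin (csqrt z * of_real pi) = 0" using z True by (simp add: phi_def sin_quot_def)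
    then obtain k :: int where "csqrt z * of_real pi = of_real (of_int k * pi)"
      by (auto simp: Complex_Transcendental.sin_eq_0)
    then have k: "csqrt z = of_int k" by simp
    then have "k \<noteq> 0" using z0 by auto
    then have "1 \<le> nat \<bar>k\<bar>" by linarith
    moreover have "z = (of_int k)\<^sup>2" using k power2_csqrt[of z] by simp
    then have "z = of_real ((free_root j (nat \<bar>k\<bar>))\<^sup>2)"
      using True by (simp add: free_root_def)
    ultimately show ?thesis by blast
  next
    case False
    then have j1: "j = 1" using j by simp
    have "cos (csqrt z * of_real pi) = 0" using z False by (simp add: phi_def)
    then obtain k :: int where "csqrt z * of_real pi = of_real (of_int k * pi + pi / 2)"
      by (auto simp: Complex_Transcendental.cos_eq_0)
    then have "csqrt z * of_real pi = of_real (of_int k + 1 / 2) * of_real pi"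
      by (simp add: algebra_simps)
    then have k: "csqrt z = of_real (of_int k + 1 / 2)" by simp
    then have z2: "z = of_real ((of_int k + 1 / 2)\<^sup>2)"
      using power2_csqrt[of z] by (metis of_real_power)
    show ?thesis
    proof (cases "k \<ge> 0")
      case True
      have "real (nat k + 1) - real j / 2 = of_int k + 1 / 2" using True j1 by simp
      then show ?thesis using z2 by (intro exI[of _ "nat k + 1"]) (simp add: free_root_def)
    next
      case False
      have e: "real (nat (- k)) - real j / 2 = - (of_int k + 1 / 2)" using False j1 by simp
      have "z = of_real ((free_root j (nat (- k)))\<^sup>2)"
        unfolding free_root_def e power2_minus by (rule z2)
      then show ?thesis using False by (intro exI[of _ "nat (- k)"]) auto
    qed
  qed
next
  assume "\<exists>n\<ge>1. z = of_real ((free_root j n)\<^sup>2)"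
  then obtain n where n: "n \<ge> 1" "z = of_real ((free_root j n)\<^sup>2)" by auto
  have pos: "free_root j n > 0" using n j by (auto simp: free_root_def)
  then have c: "csqrt z = of_real (free_root j n)"
    unfolding n by (simp add: csqrt_of_real_nonneg)
  show "phi j (csqrt z) pi = 0"
  proof (cases "j = 0")
    case True
    have "sin (of_real (real n * pi)) = (0::complex)"
      unfolding sin_of_real by simp
    then show ?thesis using True pos unfolding c by (simp add: phi_def sin_quot_def free_root_def)
  next
    case False
    have "(real n - 1 / 2) * pi = real n * pi - pi / 2" by (simp add: algebra_simps)
    then have "cos ((real n - 1 / 2) * pi) = 0" by (simp only: cos_diff) simp
    then have "cos (of_real ((real n - 1 / 2) * pi)) = (0::complex)"
      unfolding cos_of_real by simp
    then show ?thesis using False j unfolding c by (simp add: phi_def free_root_def)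
  qed
qed

text \<open>
  The chain rule for \<open>\<lambda> = \<rho>\<^sup>2\<close> gives the derivative in \<open>\<lambda>\<close> as the derivative in \<open>\<rho>\<close> over
  \<open>2 * \<rho>\<close>, which avoids the branch cut of \<open>csqrt\<close>. For \<open>j = 0\<close> the part of the quotient rule
  that contains \<open>sin (\<rho> * pi)\<close> vanishes at a zero.
\<close>

lemma deriv_phi_csqrt:
  fixes \<rho> :: complex
  assumes \<rho>: "\<rho> \<noteq> 0" and zero: "phi j \<rho> pi = 0"
  shows "deriv (\<lambda>z. phi j (csqrt z) pi) (\<rho>\<^sup>2) =
    (if j = 0 then pi * cos (\<rho> * pi) / (2 * \<rho>\<^sup>2) else - pi * sin (\<rho> * pi) / (2 * \<rho>))"
proof -
  let ?g = "\<lambda>z. phi j (csqrt z) pi"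
  have sq: "?g (w\<^sup>2) = phi j w pi" for w
  proof -
    have "(csqrt (w\<^sup>2))\<^sup>2 = w\<^sup>2" by simp
    then have "csqrt (w\<^sup>2) = w \<or> csqrt (w\<^sup>2) = - w" by (simp only: power2_eq_iff)
    then show ?thesis by (auto simp: phi_minus)
  qed
  have "(?g has_field_derivative deriv ?g (\<rho>\<^sup>2)) (at (\<rho>\<^sup>2))"
    using holomorphic_derivI[OF phi_csqrt_entire, of "\<rho>\<^sup>2"] by simp
  moreover have "((\<lambda>w. w\<^sup>2) has_field_derivative 2 * \<rho>) (at \<rho>)"
    by (auto intro!: derivative_eq_intros)
  ultimately have "((\<lambda>w. ?g (w\<^sup>2)) has_field_derivative deriv ?g (\<rho>\<^sup>2) * (2 * \<rho>)) (at \<rho>)"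
    by (rule DERIV_chain2)
  then have 1: "((\<lambda>w. phi j w pi) has_field_derivative deriv ?g (\<rho>\<^sup>2) * (2 * \<rho>)) (at \<rho>)"
    unfolding sq .
  have 2: "((\<lambda>w. phi j w pi) has_field_derivative
      (if j = 0 then pi * cos (\<rho> * pi) / \<rho> else - pi * sin (\<rho> * pi))) (at \<rho>)"
  proof (cases "j = 0")
    case True
    have s0: "sin (\<rho> * of_real pi) = 0" using zero \<rho> True by (simp add: phi_def sin_quot_def)
    have "((\<lambda>w. sin (w * of_real pi) / w) has_field_derivative
        ((cos (\<rho> * of_real pi) * of_real pi) * \<rho> - sin (\<rho> * of_real pi) * 1) / (\<rho> * \<rho>)) (at \<rho>)"
      using \<rho> by (intro DERIV_divide DERIV_ident) (auto intro!: derivative_eq_intros)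
    then have "((\<lambda>w. sin (w * of_real pi) / w) has_field_derivative pi * cos (\<rho> * pi) / \<rho>) (at \<rho>)"
      using \<rho> s0 by (simp add: mult.commute)
    moreover have "\<forall>\<^sub>F w in nhds \<rho>. sin (w * of_real pi) / w = phi j w pi"
      using t1_space_nhds[OF \<rho>] by eventually_elim (auto simp: phi_def sin_quot_def True)
    ultimately show ?thesis using True
      by (simp add: DERIV_cong_ev[OF refl _ refl, symmetric])
  next
    case False
    then show ?thesis by (auto simp: phi_def intro!: derivative_eq_intros)
  qed
  have eq: "deriv ?g (\<rho>\<^sup>2) * (2 * \<rho>) = (if j = 0 then pi * cos (\<rho> * pi) / \<rho> else - pi * sin (\<rho> * pi))"
    by (rule DERIV_unique[OF 1 2])
  have "deriv ?g (\<rho>\<^sup>2) = (deriv ?g (\<rho>\<^sup>2) * (2 * \<rho>)) / (2 * \<rho>)" using \<rho> by simp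
  then show ?thesis unfolding eq using \<rho> by (simp add: power2_eq_square)
qed

lemma trig_fun_free_root:
  assumes "j \<in> {0, 1}"
  shows "of_real (trig_fun j n x) = (trig j (of_real (free_root j n) * of_real x) :: complex)"
  using assms by (auto simp: trig_fun_def trig_def free_root_def simp flip: sin_of_real cos_of_real)

lemma free_root_pos: "j \<in> {0, 1} \<Longrightarrow> 1 \<le> n \<Longrightarrow> free_root j n > 0"
  by (auto simp: free_root_def)

lemma csqrt_free_root:
  "j \<in> {0, 1} \<Longrightarrow> 1 \<le> n \<Longrightarrow> csqrt (of_real ((free_root j n)\<^sup>2)) = of_real (free_root j n)"
  using free_root_pos[of j n] by (simp add: csqrt_of_real_nonneg)

lemma phi_free_root: "j \<in> {0, 1} \<Longrightarrow> 1 \<le> n \<Longrightarrow> phi j (of_real (free_root j n)) pi = 0"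
  using phi_csqrt_eq_0_iff[of j "of_real ((free_root j n)\<^sup>2)"] csqrt_free_root[of j n] by auto

lemma deriv_phi_free_root_nonzero:
  assumes j: "j \<in> {0, 1}" and n: "1 \<le> n"
  shows "deriv (\<lambda>z. phi j (csqrt z) pi) (of_real ((free_root j n)\<^sup>2)) \<noteq> 0"
proof -
  define \<rho> :: complex where "\<rho> = of_real (free_root j n)"
  have \<rho>: "\<rho> \<noteq> 0" using free_root_pos[OF j n] by (simp add: \<rho>_def)
  have zero: "phi j \<rho> pi = 0" unfolding \<rho>_def by (rule phi_free_root[OF j n])
  then have sc: "(if j = 0 then sin (\<rho> * pi) else cos (\<rho> * pi)) = 0"
    using \<rho> by (auto simp: phi_def sin_quot_def split: if_splits)
  have "\<not> (sin (\<rho> * pi) = 0 \<and> cos (\<rho> * pi) = 0)"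
    using sin_cos_squared_add[of "\<rho> * pi"] by (metis power_zero_numeral add_0 zero_neq_one)
  then have "(if j = 0 then cos (\<rho> * pi) else sin (\<rho> * pi)) \<noteq> 0"
    using sc by (auto split: if_splits)
  then show ?thesis
    using deriv_phi_csqrt[OF \<rho> zero] \<rho> by (simp add: \<rho>_def split: if_splits)
qed

text \<open>
  At an unperturbed eigenvalue \<open>sin_quot \<rho> (pi - t)\<close> is a multiple of the eigenfunction, so the
  residue of the Green function is a multiple of the product of eigenfunctions in its two arguments.
  The sign is that of \<open>1 / (\<lambda>\<^sub>n - \<lambda>)\<close> in the spectral expansion of the Green function.
\<close>

lemma green_num_residue:
  assumes j: "j \<in> {0, 1}" and n: "1 \<le> n"
  shows "green_num j c f (of_real (free_root j n)) /
      deriv (\<lambda>z. phi j (csqrt z) pi) (of_real ((free_root j n)\<^sup>2)) = - trig_term j c f n"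
proof -
  define \<rho> :: complex where "\<rho> = of_real (free_root j n)"
  define I where "I = (LINT t:{0..pi}|lebesgue. of_real (trig_fun j n t) * f t)"
  have \<rho>: "\<rho> \<noteq> 0" using free_root_pos[OF j n] by (simp add: \<rho>_def)
  have zero: "phi j \<rho> pi = 0" unfolding \<rho>_def by (rule phi_free_root[OF j n])
  have tf: "of_real (trig_fun j n x) = trig j (\<rho> * of_real x)" for x
    unfolding \<rho>_def by (rule trig_fun_free_root[OF j])
  define k where "k = (if j = 0 then - cos (\<rho> * pi) else sin (\<rho> * pi)) / \<rho>"
  have kernel: "sin_quot \<rho> (pi - t) = k * trig j (\<rho> * of_real t)" for t
    using zero \<rho> by (auto simp: k_def trig_def phi_def sin_quot_def right_diff_distrib sin_diff split: if_splits)
  have "sin_conv f \<rho> pi = k * I"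
    unfolding sin_conv_def I_def tf kernel by (simp add: mult.assoc)
  then have green: "green_num j c f \<rho> = phi j \<rho> c * (k * I)"
    by (simp add: green_num_def zero)
  have phi: "phi j \<rho> c = (if j = 0 then of_real (trig_fun j n c) / \<rho> else of_real (trig_fun j n c))"
    unfolding tf using \<rho> by (auto simp: phi_def trig_def sin_quot_def)
  have d: "deriv (\<lambda>z. phi j (csqrt z) pi) (\<rho>\<^sup>2) \<noteq> 0"
    using deriv_phi_free_root_nonzero[OF j n] by (simp add: \<rho>_def)
  have "green_num j c f \<rho> / deriv (\<lambda>z. phi j (csqrt z) pi) (\<rho>\<^sup>2) = - trig_term j c f n"
    using d \<rho> unfolding deriv_phi_csqrt[OF \<rho> zero] green phi trig_term_def I_def[symmetric] k_def
    by (auto simp: field_simps power2_eq_square split: if_splits)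
  then show ?thesis by (simp add: \<rho>_def)
qed

lemma free_zeros_in_disc:
  assumes j: "j \<in> {0, 1}"
  shows "{z. norm z < (real N + 1 / 2 - real j / 2)\<^sup>2 \<and> phi j (csqrt z) pi = 0}
    = (\<lambda>n. of_real ((free_root j n)\<^sup>2)) ` {1..N}"
    and "inj_on (\<lambda>n. of_real ((free_root j n)\<^sup>2) :: complex) {1..N}"
proof -
  have less: "(free_root j n)\<^sup>2 < (real N + 1 / 2 - real j / 2)\<^sup>2 \<longleftrightarrow> n \<le> N" if "1 \<le> n" for n
  proof -
    have "0 \<le> free_root j n" using free_root_pos[OF j that] by simp
    moreover have "0 \<le> real N + 1 / 2 - real j / 2" using j by auto
    ultimately have "(free_root j n)\<^sup>2 < (real N + 1 / 2 - real j / 2)\<^sup>2 \<longleftrightarrow> free_root j n < real N + 1 / 2 - real j / 2"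
      by (simp add: power_mono_iff flip: not_le)
    also have "\<dots> \<longleftrightarrow> n \<le> N" by (simp add: free_root_def) linarith
    finally show ?thesis .
  qed
  show "{z. norm z < (real N + 1 / 2 - real j / 2)\<^sup>2 \<and> phi j (csqrt z) pi = 0}
    = (\<lambda>n. of_real ((free_root j n)\<^sup>2)) ` {1..N}"
    using less unfolding phi_csqrt_eq_0_iff[OF j] by (auto simp del: of_real_power)
  show "inj_on (\<lambda>n. of_real ((free_root j n)\<^sup>2) :: complex) {1..N}"
  proof (rule inj_onI)
    fix m n assume "m \<in> {1..N}" "n \<in> {1..N}"
      "of_real ((free_root j m)\<^sup>2) = (of_real ((free_root j n)\<^sup>2) :: complex)"
    then have "free_root j m = free_root j n"
      using free_root_pos[OF j, of m] free_root_pos[OF j, of n]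
      by (simp add: power2_eq_iff_nonneg del: of_real_power)
    then show "m = n" by (simp add: free_root_def)
  qed
qed

section \<open>Comparison of the partial sums\<close>

text \<open>
  An enumeration by nondecreasing modulus lists the zeros of an open disc first, so the indices that
  fall into the disc form an initial segment, whose length is the number of zeros.
\<close>

lemma sum_enumerated_zeros:
  fixes lam :: "nat \<Rightarrow> complex"
  assumes f: "f holomorphic_on UNIV" and w: "f w \<noteq> 0"
    and mono: "\<And>m n. 1 \<le> m \<Longrightarrow> m \<le> n \<Longrightarrow> norm (lam m) \<le> norm (lam n)"
    and fin: "\<And>z. finite {n. 1 \<le> n \<and> lam n = z}"
    and mult: "\<And>z. int (card {n. 1 \<le> n \<and> lam n = z}) = zorder f z"
    and count: "(\<Sum>z | norm z < r \<and> f z = 0. of_int (zorder f z)) = (of_nat N :: complex)"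
  shows "(\<Sum>z | norm z < r \<and> f z = 0. z * of_int (zorder f z)) = (\<Sum>n=1..N. lam n)"
proof -
  let ?Z = "{z. norm z < r \<and> f z = 0}"
  define I where "I = {n. 1 \<le> n \<and> norm (lam n) < r}"
  have finZ: "finite ?Z"
    by (rule finite_subset[OF _ finite_zeros_cball[OF f w, of r]]) auto
  have zero: "f (lam n) = 0" if "1 \<le> n" for n
  proof (rule ccontr)
    assume "f (lam n) \<noteq> 0"
    then have "zorder f (lam n) = 0"
      using f by (intro zorder_eq_0I) (auto simp: analytic_on_open holomorphic_on_imp_analytic_at)
    then have "card {m. 1 \<le> m \<and> lam m = lam n} = 0" using mult[of "lam n"] by simp
    then show False using fin[of "lam n"] that by auto
  qed
  have I: "I = (\<Union>z\<in>?Z. {n. 1 \<le> n \<and> lam n = z})"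
    using zero by (auto simp: I_def)
  have finI: "finite I" unfolding I using finZ fin by auto
  have sum_I: "(\<Sum>n\<in>I. h (lam n)) = (\<Sum>z\<in>?Z. h z * of_int (zorder f z))" for h :: "complex \<Rightarrow> complex"
  proof -
    have "(\<Sum>n\<in>I. h (lam n)) = (\<Sum>z\<in>?Z. \<Sum>n\<in>{n. 1 \<le> n \<and> lam n = z}. h (lam n))"
      unfolding I using finZ fin by (intro sum.UNION_disjoint) auto
    also have "\<dots> = (\<Sum>z\<in>?Z. h z * of_int (zorder f z))"
      by (intro sum.cong refl) (simp add: mult[symmetric])
    finally show ?thesis .
  qed
  have "of_nat (card I) = (of_nat N :: complex)"
    using sum_I[of "\<lambda>_. 1"] count by simp
  then have card: "card I = N" by simp
  have "I = {1..N}"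
  proof -
    have down: "m \<in> I" if "n \<in> I" "1 \<le> m" "m \<le> n" for m n
      using that mono[of m n] by (auto simp: I_def)
    have "I \<subseteq> {1..N}"
    proof
      fix n assume n: "n \<in> I"
      then have "{1..n} \<subseteq> I" using down by auto
      then have "card {1..n} \<le> card I" by (rule card_mono[OF finI])
      then show "n \<in> {1..N}" using n card by (auto simp: I_def)
    qed
    then show ?thesis using card by (intro card_subset_eq) auto
  qed
  then show ?thesis using sum_I[of "\<lambda>z. z"] by simp
qed

text \<open>
  The error is at most \<open>r * B\<close> with \<open>R = N + 1/2 - j/2\<close>, \<open>r = R\<^sup>2\<close> and \<open>B = 34 * (\<delta> / R)\<^sup>2\<close>:
  the growth of the contour is compensated exactly, and \<open>\<delta>\<close> is arbitrarily small.
\<close>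

lemma spectral_partial_sums:
  fixes lam :: "nat \<Rightarrow> complex"
  assumes ab: "0 \<le> a" "a \<le> pi" "0 \<le> b" "b \<le> pi"
    and p: "p absolutely_integrable_on {0..pi}" and q: "q absolutely_integrable_on {0..pi}"
    and j: "j \<in> {0, 1}" and spec: "is_spectrum j a b p q lam"
  shows "(\<lambda>N. \<Sum>n=1..N. (lam n - of_real ((free_root j n)\<^sup>2)) - (trig_term j a p n + trig_term j b q n))
    \<longlonglongrightarrow> 0"
proof (rule LIMSEQ_I)
  fix e :: real assume e: "0 < e"
  \<comment> \<open>The estimate of the logarithm needs 1/8; with e/34 the final error is at most 34 * \<delta>^2 < e.\<close>
  define \<delta> where "\<delta> = min (1 / 8) (e / 34)"
  have \<delta>: "0 < \<delta>" "\<delta> \<le> 1 / 8" "34 * \<delta> \<le> e" using e by (auto simp: \<delta>_def)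
  have "34 * (\<delta> * \<delta>) < 34 * (\<delta> * 1)" using \<delta> by (intro mult_strict_left_mono) auto
  then have \<delta>e: "34 * \<delta>\<^sup>2 < e" using \<delta>(3) unfolding power2_eq_square by linarith
  let ?small = "\<lambda>c f \<rho>. \<forall>N\<ge>1. norm \<rho> = real N + 1 / 2 - real j / 2 \<longrightarrow>
      norm (green_num j c f \<rho> / phi j \<rho> pi) \<le> \<delta> / norm \<rho>"
  \<comment> \<open>All four entries of the matrix M are small on the circles of large radius.\<close>
  have "\<forall>\<^sub>F \<rho> in at_infinity. ?small a p \<rho> \<and> ?small a q \<rho> \<and> ?small b p \<rho> \<and> ?small b q \<rho>"
    using ab p q j \<delta> by (intro eventually_conj green_quotient_small) auto
  then obtain M where M: "\<And>\<rho>. M \<le> norm \<rho> \<Longrightarrow> ?small a p \<rho> \<and> ?small a q \<rho> \<and> ?small b p \<rho> \<and> ?small b q \<rho>"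
    by (auto simp: eventually_at_infinity)
  define f where "f = char_fun j a b p q"
  define g where "g = (\<lambda>z. phi j (csqrt z) pi)"
  define u where "u = (\<lambda>z. green_num j a p (csqrt z) + green_num j b q (csqrt z))"
  have f: "f holomorphic_on UNIV" unfolding f_def using ab p q by (rule char_fun_entire)
  have g: "g holomorphic_on UNIV" unfolding g_def by (rule phi_csqrt_entire)
  have u: "u holomorphic_on UNIV"
    unfolding u_def using ab p q by (intro holomorphic_intros green_num_csqrt_entire)
  have "norm ((\<Sum>n=1..N. (lam n - of_real ((free_root j n)\<^sup>2)) - (trig_term j a p n + trig_term j b q n)) - 0) < e"
    if N: "N \<ge> max 1 (nat \<lceil>M\<rceil>)" for N
  proof -
    have N1: "1 \<le> N" and NM: "M \<le> real N" using N by linarith+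
    define R where "R = real N + 1 / 2 - real j / 2"
    define r where "r = R\<^sup>2"
    have R1: "1 \<le> R" and RM: "M \<le> R" using N1 NM j by (auto simp: R_def)
    have r: "r > 0" using R1 by (simp add: r_def)
    have root: "norm (csqrt z) = R" if "norm z = r" for z
      using that R1 by (simp add: norm_csqrt r_def)
    have nz: "g z \<noteq> 0" if "norm z = r" for z
    proof -
      have "exp (\<bar>Im (csqrt z)\<bar> * pi) \<le> 5 * norm (trig j (csqrt z * of_real pi))"
        using root[OF that] by (intro trig_lower_bound[OF j N1]) (simp add: R_def)
      then have "norm (trig j (csqrt z * of_real pi)) > 0"
        using exp_gt_zero[of "\<bar>Im (csqrt z)\<bar> * pi"] by linarith
      moreover have "csqrt z \<noteq> 0" using root[OF that] R1 by auto
      ultimately show ?thesis using phi_eq_trig[OF j, of "csqrt z" pi] by (auto simp: g_def)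
    qed
    have bounds: "norm (f z / g z - 1) \<le> 1 / 2 \<and> norm (Ln (f z / g z) - u z / g z) \<le> 34 * (\<delta> / R)\<^sup>2"
      if z: "norm z = r" for z
    proof -
      let ?x = "\<lambda>c h. green_num j c h (csqrt z) / g z"
      have "?small a p (csqrt z) \<and> ?small a q (csqrt z) \<and> ?small b p (csqrt z) \<and> ?small b q (csqrt z)"
        by (rule M) (simp only: root[OF z] RM)
      then have xs: "norm (?x a p) \<le> \<delta> / R" "norm (?x a q) \<le> \<delta> / R" "norm (?x b p) \<le> \<delta> / R" "norm (?x b q) \<le> \<delta> / R"
        using N1 root[OF z] by (auto simp: R_def g_def)
      have "\<delta> / R \<le> \<delta> / 1" using R1 \<delta> by (intro divide_left_mono) auto
      also have "\<dots> \<le> 1 / 8" using \<delta> by simp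
      finally have \<eta>: "\<delta> / R \<le> 1 / 8" .
      have "f z * g z = (g z + green_num j a p (csqrt z)) * (g z + green_num j b q (csqrt z))
          - green_num j a q (csqrt z) * green_num j b p (csqrt z)"
        unfolding f_def g_def char_fun_def by (rule char_det_green)
      then have "f z * g z / (g z * g z) = ((g z + green_num j a p (csqrt z)) * (g z + green_num j b q (csqrt z))
          - green_num j a q (csqrt z) * green_num j b p (csqrt z)) / (g z * g z)"
        by (rule arg_cong)
      also have "\<dots> = (1 + ?x a p) * (1 + ?x b q) - ?x a q * ?x b p"
        using nz[OF z] by (simp add: field_simps)
      finally have ratio: "f z / g z = (1 + ?x a p) * (1 + ?x b q) - ?x a q * ?x b p"
        using nz[OF z] by simp
      have tr: "u z / g z = ?x a p + ?x b q" by (simp add: u_def add_divide_distrib)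
      show ?thesis
        unfolding ratio tr using norm_Ln_det2_minus_trace_le[OF xs \<eta>] by blast
    qed
    have simple: "deriv g z \<noteq> 0" if "g z = 0" for z
    proof -
      from that obtain n where "1 \<le> n" "z = of_real ((free_root j n)\<^sup>2)"
        using phi_csqrt_eq_0_iff[OF j, of z] by (auto simp: g_def)
      then show ?thesis using deriv_phi_free_root_nonzero[OF j, of n] by (simp add: g_def)
    qed
    have close: "norm (f z / g z - 1) < 1" if "norm z = r" for z
      using bounds[OF that] by auto
    have B: "norm (Ln (f z / g z) - u z / g z) \<le> 34 * (\<delta> / R)\<^sup>2" if "norm z = r" for z
      using bounds[OF that] by blast
    have Z: "{z. norm z < r \<and> g z = 0} = (\<lambda>n. of_real ((free_root j n)\<^sup>2)) ` {1..N}"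
      unfolding r_def R_def g_def by (rule free_zeros_in_disc[OF j])
    have inj: "inj_on (\<lambda>n. of_real ((free_root j n)\<^sup>2) :: complex) {1..N}"
      by (rule free_zeros_in_disc[OF j])
    note pert = zero_sum_perturbation[OF f g u r nz simple close _ B]
    have count: "(\<Sum>z | norm z < r \<and> f z = 0. of_int (zorder f z)) = (of_nat N :: complex)"
      using pert(1) unfolding Z card_image[OF inj] by simp
    have "norm (of_real r :: complex) = r" using r by simp
    then have w: "f (of_real r) \<noteq> 0" using close[of "of_real r"] by auto
    have lam_sum: "(\<Sum>z | norm z < r \<and> f z = 0. z * of_int (zorder f z)) = (\<Sum>n=1..N. lam n)"
      by (rule sum_enumerated_zeros[OF f w _ _ _ count])
         (use spec in \<open>auto simp: is_spectrum_def f_def\<close>)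
    have free_sum: "(\<Sum>z | norm z < r \<and> g z = 0. z) = (\<Sum>n=1..N. of_real ((free_root j n)\<^sup>2))"
      unfolding Z sum.reindex[OF inj] by simp
    have res_sum: "(\<Sum>z | norm z < r \<and> g z = 0. u z / deriv g z)
        = (\<Sum>n=1..N. - (trig_term j a p n + trig_term j b q n))"
      unfolding Z sum.reindex[OF inj] o_def
    proof (rule sum.cong[OF refl])
      fix n assume "n \<in> {1..N}"
      then have n: "1 \<le> n" by simp
      show "u (of_real ((free_root j n)\<^sup>2)) / deriv g (of_real ((free_root j n)\<^sup>2))
          = - (trig_term j a p n + trig_term j b q n)"
        unfolding u_def g_def csqrt_free_root[OF j n] add_divide_distrib green_num_residue[OF j n]
        by simp
    qed
    have "norm ((\<Sum>n=1..N. lam n) - (\<Sum>n=1..N. of_real ((free_root j n)\<^sup>2))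
        + (\<Sum>n=1..N. - (trig_term j a p n + trig_term j b q n))) \<le> r * (34 * (\<delta> / R)\<^sup>2)"
      using pert(2) unfolding lam_sum free_sum res_sum by simp
    also have "r * (34 * (\<delta> / R)\<^sup>2) = 34 * \<delta>\<^sup>2"
      using R1 by (simp add: r_def power_divide)
    also note \<delta>e
    finally show ?thesis by (simp add: sum_subtractf sum_negf sum.distrib algebra_simps)
  qed
  then show "\<exists>no. \<forall>N\<ge>no. norm ((\<Sum>n=1..N. (lam n - of_real ((free_root j n)\<^sup>2))
      - (trig_term j a p n + trig_term j b q n)) - 0) < e"
    by blast
qed

theorem theorem5p1:
  fixes a b :: real and p q :: "real \<Rightarrow> complex" and j :: nat
    and lam s :: "nat \<Rightarrow> complex"
  assumes "0 < a" and "a < b" and "b < pi"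
    and "p absolutely_integrable_on {0..pi}"
    and "q absolutely_integrable_on {0..pi}"
    and "j \<in> {0, 1}"
    and "is_spectrum j a b p q lam"
    and "\<And>n. 1 \<le> n \<Longrightarrow> s n = trig_term j a p n + trig_term j b q n"
  shows "(summable (\<lambda>n. lam (Suc n) - of_real ((real (Suc n) - real j / 2)\<^sup>2))
            \<longleftrightarrow> summable (\<lambda>n. s (Suc n))) \<and>
         (summable (\<lambda>n. s (Suc n)) \<longrightarrow>
            (\<Sum>n. lam (Suc n) - of_real ((real (Suc n) - real j / 2)\<^sup>2)) = (\<Sum>n. s (Suc n)))"
proof -
  define X where "X n = lam (Suc n) - of_real ((real (Suc n) - real j / 2)\<^sup>2)" for n
  define Y where "Y n = s (Suc n)" for n
  have "(\<Sum>n=1..N. (lam n - of_real ((free_root j n)\<^sup>2)) - (trig_term j a p n + trig_term j b q n))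
      = (\<Sum>n<N. X n - Y n)" for N
  proof -
    have "(\<Sum>n=1..N. (lam n - of_real ((free_root j n)\<^sup>2)) - (trig_term j a p n + trig_term j b q n))
        = (\<Sum>n=1..N. (lam n - of_real ((free_root j n)\<^sup>2)) - s n)"
      using assms(8) by (intro sum.cong) auto
    also have "\<dots> = (\<Sum>n<N. X n - Y n)"
      unfolding X_def Y_def free_root_def
      by (rule sum.reindex_bij_witness[of _ Suc "\<lambda>n. n - 1"]) auto
    finally show ?thesis .
  qed
  then have D: "(\<lambda>n. X n - Y n) sums 0"
    using spectral_partial_sums[of a b p q j lam] assms by (simp add: sums_def)
  have "summable X \<longleftrightarrow> summable Y"
    using summable_add[OF sums_summable[OF D], of Y] summable_diff[OF _ sums_summable[OF D], of X] by auto
  moreover have "suminf X = suminf Y" if "summable Y"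
    using sums_unique[OF sums_add[OF D summable_sums[OF that]]] by simp
  ultimately show ?thesis unfolding X_def[abs_def] Y_def[abs_def] by blast
qed

end
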